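(* Let $q=3^h$ with $h\ge2$, let $\tau=\operatorname{Tr}_{\mathbb F_q/\mathbb F_3}$, and put $$\eta=2-\frac{3\sqrt2}{2},\qquad r=\frac{-1+\sqrt{9-6\sqrt2}}2,\qquad a=\frac q3,\qquad N_q=2a-1+2a\eta=q(2-\sqrt2)-1.$$ The real unit vector $\phi_q\in\mathbb R^{\mathbb F_q^\times}$ given by $$\phi_q(m)=\frac1{\sqrt{N_q}}\begin{cases}1,&\tau(m)=0,\\ r,&\tau(m)=1,\\ -1-r,&\tau(m)=2\end{cases}\qquad(m\in\mathbb F_q^\times)$$ satisfies $$\min_{\chi\ne\mathbf 1}|c_{\phi_q}(\chi)|=\sigma_{\min}(B_{\phi_q})=\frac{\sqrt{a(1+4\eta)}}{N_q}.$$ Consequently, $$\sigma_{\min}(\mathcal M_{\phi_q})=\frac{q(\sqrt2-1)}{q(2-\sqrt2)-1}>\frac1{\sqrt2}.$$ In particular, these exact stability constants decrease to $1/\sqrt2$ as $h\to\infty$.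
   Context: $G_q=\mathbb F_q\rtimes\mathbb F_q^\times$ is the affine group with product $(k,l)(k',l')=(k+lk',ll')$, acting on $\mathbb C^{\mathbb F_q^\times}$ by the unitary representation $(\pi_q(k,l)f)(m)=\psi_0(km)f(lm)$, where $\psi_0$ is any fixed nontrivial additive character of $\mathbb F_q$. For a vector $\phi$, $\mathcal M_\phi:\mathbb C^{\mathbb F_q^\times\times\mathbb F_q^\times}\to\mathbb C^{G_q}$ is the linear map $\mathcal M_\phi(A)(g)=\langle A\pi_q(g)\phi,\pi_q(g)\phi\rangle$, and $\sigma_{\min}(\mathcal M_\phi)=\min_{A\ne0}\|\mathcal M_\phi(A)\|_{\ell^2(G_q)}/\|A\|_F$ (Frobenius norm; counting measure on $G_q$). For a real vector $\phi$: $c_\phi(\chi)=\sum_{m\in\mathbb F_q^\times}|\phi(-m)|^2\chi(m)$ for multiplicative characters $\chi$ of $\mathbb F_q^\times$ ($\mathbf 1$ is the trivial one), and $B_\phi$ is the $(q-1)\times(q-2)$ matrix with entries $B_\phi(m,t)=\phi(mt)\phi(m(t+1))$, $m\in\mathbb F_q^\times$, $t\in\mathbb F_q\setminus\{0,-1\}$; $\sigma_{\min}(B_\phi)=\min_{z\neq 0}\|B_\phi z\|/\|z\|$ is its smallest of $q-2$ singular values. *)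

theory Defs
  imports "HOL-Analysis.Analysis" "HOL-Algebra.Multiplicative_Group"
begin

text \<open>
  Finite fields are rings in the sense of the algebra library, since the field with
  $3^h$ elements has to vary with $h$ inside the statement. Its multiplicative group is
  \<^const>\<open>mult_of\<close>. A vector or a matrix with index set $X$ is a function whose
  values outside $X$ are irrelevant.
\<close>

definition l2_norm :: "'i set \<Rightarrow> ('i \<Rightarrow> complex) \<Rightarrow> real" where
  "l2_norm X f = L2_set (\<lambda>x. cmod (f x)) X"

text \<open>
  Smallest singular value of a linear map $T$ from the functions on $X$ to the functions
  on $Y$. Using \<open>LEAST\<close> rather than \<open>Inf\<close> renders a minimum: an equation
  for it can only be established by exhibiting a minimiser.
\<close>

definition sigma_min ::
    "'i set \<Rightarrow> 'j set \<Rightarrow> (('i \<Rightarrow> complex) \<Rightarrow> 'j \<Rightarrow> complex) \<Rightarrow> real" where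
  "sigma_min X Y T =
     (LEAST s. \<exists>f. (\<exists>x\<in>X. f x \<noteq> 0) \<and> s = l2_norm Y (T f) / l2_norm X f)"

definition is_character :: "('a, 'm) monoid_scheme \<Rightarrow> ('a \<Rightarrow> complex) \<Rightarrow> bool" where
  "is_character G \<omega> \<longleftrightarrow>
     (\<forall>x\<in>carrier G. cmod (\<omega> x) = 1) \<and>
     (\<forall>x\<in>carrier G. \<forall>y\<in>carrier G. \<omega> (x \<otimes>\<^bsub>G\<^esub> y) = \<omega> x * \<omega> y)"

definition nontrivial_character :: "('a, 'm) monoid_scheme \<Rightarrow> ('a \<Rightarrow> complex) \<Rightarrow> bool" where
  "nontrivial_character G \<omega> \<longleftrightarrow> is_character G \<omega> \<and> (\<exists>x\<in>carrier G. \<omega> x \<noteq> 1)"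

definition affine_group :: "('a, 'm) ring_scheme \<Rightarrow> ('a \<times> 'a) monoid" where
  "affine_group R =
     \<lparr> carrier = carrier R \<times> carrier (mult_of R),
       mult = (\<lambda>(k, l) (k', l'). (k \<oplus>\<^bsub>R\<^esub> l \<otimes>\<^bsub>R\<^esub> k', l \<otimes>\<^bsub>R\<^esub> l')),
       one = (\<zero>\<^bsub>R\<^esub>, \<one>\<^bsub>R\<^esub>) \<rparr>"

definition affine_rep ::
    "('a, 'm) ring_scheme \<Rightarrow> ('a \<Rightarrow> complex) \<Rightarrow> 'a \<times> 'a \<Rightarrow> ('a \<Rightarrow> complex) \<Rightarrow> 'a \<Rightarrow> complex" where
  "affine_rep R \<psi> g f m =
     \<psi> (fst g \<otimes>\<^bsub>R\<^esub> m) * f (snd g \<otimes>\<^bsub>R\<^esub> m)"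

text \<open>
  The inner product is linear in its first argument, which makes the map below linear
  in the matrix $A$.
\<close>

definition matrix_apply :: "'j set \<Rightarrow> ('i \<times> 'j \<Rightarrow> complex) \<Rightarrow> ('j \<Rightarrow> complex) \<Rightarrow> 'i \<Rightarrow> complex" where
  "matrix_apply J A v i = (\<Sum>j\<in>J. A (i, j) * v j)"

definition l2_inner :: "'i set \<Rightarrow> ('i \<Rightarrow> complex) \<Rightarrow> ('i \<Rightarrow> complex) \<Rightarrow> complex" where
  "l2_inner X u v = (\<Sum>x\<in>X. u x * cnj (v x))"

definition M_map ::
    "('a, 'm) ring_scheme \<Rightarrow> ('a \<Rightarrow> complex) \<Rightarrow> ('a \<Rightarrow> complex) \<Rightarrow>
     ('a \<times> 'a \<Rightarrow> complex) \<Rightarrow> 'a \<times> 'a \<Rightarrow> complex" where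
  "M_map R \<psi> \<phi> A g =
     l2_inner (carrier (mult_of R))
       (matrix_apply (carrier (mult_of R)) A (affine_rep R \<psi> g \<phi>))
       (affine_rep R \<psi> g \<phi>)"

definition sigma_min_M ::
    "('a, 'm) ring_scheme \<Rightarrow> ('a \<Rightarrow> complex) \<Rightarrow> ('a \<Rightarrow> complex) \<Rightarrow> real" where
  "sigma_min_M R \<psi> \<phi> =
     sigma_min (carrier (mult_of R) \<times> carrier (mult_of R)) (carrier (affine_group R))
       (M_map R \<psi> \<phi>)"

definition c_coeff :: "('a, 'm) ring_scheme \<Rightarrow> ('a \<Rightarrow> real) \<Rightarrow> ('a \<Rightarrow> complex) \<Rightarrow> complex" where
  "c_coeff R \<phi> \<omega> =
     (\<Sum>m\<in>carrier (mult_of R). complex_of_real (\<bar>\<phi> (\<ominus>\<^bsub>R\<^esub> m)\<bar>\<^sup>2) * \<omega> m)"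

definition B_mat :: "('a, 'm) ring_scheme \<Rightarrow> ('a \<Rightarrow> real) \<Rightarrow> 'a \<times> 'a \<Rightarrow> real" where
  "B_mat R \<phi> = (\<lambda>(m, t). \<phi> (m \<otimes>\<^bsub>R\<^esub> t) * \<phi> (m \<otimes>\<^bsub>R\<^esub> (t \<oplus>\<^bsub>R\<^esub> \<one>\<^bsub>R\<^esub>)))"

definition sigma_min_B :: "('a, 'm) ring_scheme \<Rightarrow> ('a \<Rightarrow> real) \<Rightarrow> real" where
  "sigma_min_B R \<phi> =
     (let J = carrier R - {\<zero>\<^bsub>R\<^esub>, \<ominus>\<^bsub>R\<^esub> \<one>\<^bsub>R\<^esub>}
      in sigma_min J (carrier (mult_of R))
           (matrix_apply J (\<lambda>i. complex_of_real (B_mat R \<phi> i))))"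

text \<open>
  Absolute trace of a field with $p^h$ elements, as the sum of the conjugates
  $x^{p^i}$; its values lie in the prime field.
\<close>

definition abs_trace :: "('a, 'm) ring_scheme \<Rightarrow> nat \<Rightarrow> nat \<Rightarrow> 'a \<Rightarrow> 'a" where
  "abs_trace R p h x = (\<Oplus>\<^bsub>R\<^esub>i\<in>{..<h}. x [^]\<^bsub>R\<^esub> (p ^ i))"

definition eta_const :: real where
  "eta_const = 2 - 3 * sqrt 2 / 2"

definition r_const :: real where
  "r_const = (- 1 + sqrt (9 - 6 * sqrt 2)) / 2"

definition a_const :: "nat \<Rightarrow> real" where
  "a_const q = real q / 3"

definition N_const :: "nat \<Rightarrow> real" where
  "N_const q = 2 * a_const q - 1 + 2 * a_const q * eta_const"

text \<open>The last branch is the case of trace $2$.\<close>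

definition phi_vec :: "('a, 'm) ring_scheme \<Rightarrow> nat \<Rightarrow> 'a \<Rightarrow> real" where
  "phi_vec R h m =
     1 / sqrt (N_const (3 ^ h)) *
     (if abs_trace R 3 h m = \<zero>\<^bsub>R\<^esub> then 1
      else if abs_trace R 3 h m = \<one>\<^bsub>R\<^esub> then r_const
      else - 1 - r_const)"

abbreviation phi_cvec :: "('a, 'm) ring_scheme \<Rightarrow> nat \<Rightarrow> 'a \<Rightarrow> complex" where
  "phi_cvec R h \<equiv> (\<lambda>m. complex_of_real (phi_vec R h m))"

end

(* Write kappa = q (sqrt 2 - 1)^2 and let E be the all-ones matrix. Traces of elements that are
   linearly independent over F_3 are jointly equidistributed, so every entry of the Gram matrix of
   B_phi, and of that of the matrix (phi(l m)^2), is a polynomial in r. The value of r, a root of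
   r^4 + 2 r^3 - 3 r^2 - 4 r - 1/2, collapses these Gram matrices to (kappa (I + E) - E) / N_q^2 and
   (kappa (I + 2 E) - E) / N_q^2. As kappa >= 1, both have least eigenvalue kappa / N_q^2, attained
   on vectors of sum zero, among them the nontrivial multiplicative characters. Parseval in the
   translation variable splits M_phi(A) along the fibres n - m = d: the diagonal d = 0 contributes
   the matrix (phi(l m)^2), every other d contributes a copy of B_phi. *)

theory Submission
  imports Defs
begin

section \<open>Least singular values from Gram matrices\<close>

text \<open>The values 1, r, -1-r have sum zero and, with eta = r^2 + r, square sum 2(1+eta). Sum
  zero then forces the fourth-power sum 2(1+eta)^2 and the cyclic autocorrelations 2(1+eta),
  -(1+eta), -(1+eta). Summed over all l in F_q and up to 1/N_q^2, the Gram entries of (phi(l m)^2)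
  are therefore 2q(1+eta)^2/3 for m = m', 4q(1+eta)^2/9 for m, m' independent over F_3, and q(1+2
  eta^2)/3 for m' = -m. The last two agree exactly when eta^2 = 4 eta + 1/2, which is the quartic in
  r and has 2 - 3 sqrt 2/2 as a root. It turns 2(1+eta)^2 into 3(1+4 eta), so kappa = q(1+4 eta)/3.
  The same relation levels the entries for B_phi. The summand -E is the missing index 0, where every
  trace vanishes and the summand is 1. For q = 9 and beyond, kappa >= 1 keeps the coefficient of E
  nonnegative. Parseval contributes a factor q, and q kappa is the square of q (sqrt 2 - 1), which
  is why the last formula has no outer root.\<close>

lemma character_sum_eq_0:
  assumes "group G" and "nontrivial_character G \<omega>"
  shows "(\<Sum>x\<in>carrier G. \<omega> x) = 0"
proof -
  interpret group G by fact
  obtain y where y: "y \<in> carrier G" "\<omega> y \<noteq> 1"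
    and mul: "\<And>x. x \<in> carrier G \<Longrightarrow> \<omega> (y \<otimes>\<^bsub>G\<^esub> x) = \<omega> y * \<omega> x"
    using assms(2) unfolding nontrivial_character_def is_character_def by blast
  have "bij_betw (\<lambda>x. y \<otimes>\<^bsub>G\<^esub> x) (carrier G) (carrier G)"
    using y(1) by (simp add: bij_betw_def inj_on_cmult surj_const_mult)
  then have "(\<Sum>x\<in>carrier G. \<omega> x) = (\<Sum>x\<in>carrier G. \<omega> (y \<otimes>\<^bsub>G\<^esub> x))"
    by (rule sum.reindex_bij_betw[symmetric])
  also have "\<dots> = \<omega> y * (\<Sum>x\<in>carrier G. \<omega> x)"
    by (simp add: mul sum_distrib_left)
  finally show ?thesis
    using y(2) by simp
qed

text \<open>The Gram matrix is \<alpha> I + \<beta> E with E all ones, and E has quadratic form the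
  squared modulus of the sum. On vectors of sum zero only \<alpha> survives. With \<beta> = 0 this
  also yields Parseval.\<close>

lemma gram_form:
  fixes b :: "'i \<Rightarrow> 'j \<Rightarrow> complex"
  assumes "finite J"
    and gram: "\<And>j j'. j \<in> J \<Longrightarrow> j' \<in> J \<Longrightarrow>
      (\<Sum>i\<in>I. b i j * cnj (b i j')) = of_real ((if j = j' then \<alpha> else 0) + \<beta>)"
  shows "(\<Sum>i\<in>I. (cmod (\<Sum>j\<in>J. b i j * z j))\<^sup>2)
    = \<alpha> * (\<Sum>j\<in>J. (cmod (z j))\<^sup>2) + \<beta> * (cmod (\<Sum>j\<in>J. z j))\<^sup>2"
proof -
  have "complex_of_real (\<Sum>i\<in>I. (cmod (\<Sum>j\<in>J. b i j * z j))\<^sup>2)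
      = (\<Sum>i\<in>I. \<Sum>j\<in>J. \<Sum>j'\<in>J. b i j * z j * (cnj (b i j') * cnj (z j')))"
    by (simp add: complex_norm_square sum_product del: of_real_power)
  also have "\<dots> = (\<Sum>j\<in>J. \<Sum>j'\<in>J. \<Sum>i\<in>I. b i j * z j * (cnj (b i j') * cnj (z j')))"
    by (subst sum.swap, rule sum.cong[OF refl], rule sum.swap)
  also have "\<dots> = (\<Sum>j\<in>J. \<Sum>j'\<in>J. z j * cnj (z j') * (\<Sum>i\<in>I. b i j * cnj (b i j')))"
    by (simp add: sum_distrib_left mult_ac)
  also have "\<dots> = (\<Sum>j\<in>J. \<Sum>j'\<in>J. (if j = j' then z j * cnj (z j') * of_real \<alpha> else 0)
      + z j * cnj (z j') * of_real \<beta>)"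
    by (intro sum.cong refl) (simp add: gram distrib_left)
  also have "\<dots> = (\<Sum>j\<in>J. z j * cnj (z j) * of_real \<alpha>) + (\<Sum>j\<in>J. \<Sum>j'\<in>J. z j * cnj (z j')) * of_real \<beta>"
    using assms(1) by (simp add: sum.distrib sum_distrib_right)
  also have "\<dots> = complex_of_real (\<alpha> * (\<Sum>j\<in>J. (cmod (z j))\<^sup>2) + \<beta> * (cmod (\<Sum>j\<in>J. z j))\<^sup>2)"
    unfolding of_real_add of_real_mult of_real_sum complex_norm_square cnj_sum sum_product
    by (simp add: sum_distrib_left mult.commute)
  finally show ?thesis
    unfolding of_real_eq_iff .
qed

lemma l2_norm_power2: "(l2_norm X f)\<^sup>2 = (\<Sum>x\<in>X. (cmod (f x))\<^sup>2)"
  by (simp add: l2_norm_def L2_set_def sum_nonneg)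

lemma l2_norm_nonneg: "0 \<le> l2_norm X f"
  by (simp add: l2_norm_def)

lemma l2_norm_pos:
  assumes "finite X" "x \<in> X" "f x \<noteq> 0"
  shows "0 < l2_norm X f"
proof -
  have "l2_norm X f \<noteq> 0"
    using assms by (auto simp: l2_norm_def L2_set_eq_0_iff)
  with l2_norm_nonneg[of X f] show ?thesis by simp
qed

text \<open>Here \<alpha> is the square of the singular value, so the hypotheses are about quadratic
  forms. A \<open>LEAST\<close> needs an attaining \<open>f\<close>; the point \<open>x\<close> only
  certifies that \<open>f\<close> is nonzero.\<close>

lemma sigma_min_eqI:
  assumes "finite X" "0 \<le> \<alpha>"
    and lower: "\<And>f. \<alpha> * (\<Sum>x\<in>X. (cmod (f x))\<^sup>2) \<le> (\<Sum>y\<in>Y. (cmod (T f y))\<^sup>2)"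
    and x: "x \<in> X" "f x \<noteq> 0"
    and attained: "(\<Sum>y\<in>Y. (cmod (T f y))\<^sup>2) = \<alpha> * (\<Sum>x\<in>X. (cmod (f x))\<^sup>2)"
  shows "sigma_min X Y T = sqrt \<alpha>"
  unfolding sigma_min_def
proof (rule Least_equality)
  have "l2_norm Y (T f) = sqrt \<alpha> * l2_norm X f"
    by (rule power2_eq_imp_eq)
      (use attained assms(2) in \<open>simp_all add: power_mult_distrib l2_norm_power2 l2_norm_nonneg\<close>)
  then show "\<exists>f. (\<exists>x\<in>X. f x \<noteq> 0) \<and> sqrt \<alpha> = l2_norm Y (T f) / l2_norm X f"
    using x l2_norm_pos[OF assms(1), of x f] by (intro exI[of _ f]) auto
next
  fix s assume "\<exists>f. (\<exists>x\<in>X. f x \<noteq> 0) \<and> s = l2_norm Y (T f) / l2_norm X f"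
  then obtain g where g: "\<exists>x\<in>X. g x \<noteq> 0" and s: "s = l2_norm Y (T g) / l2_norm X g"
    by blast
  have pos: "0 < l2_norm X g"
    using g l2_norm_pos[OF assms(1)] by blast
  have "sqrt \<alpha> * l2_norm X g \<le> l2_norm Y (T g)"
    by (rule power2_le_imp_le)
      (use lower[of g] assms(2) in \<open>simp_all add: power_mult_distrib l2_norm_power2 l2_norm_nonneg\<close>)
  with pos show "sqrt \<alpha> \<le> s"
    by (simp add: s pos_le_divide_eq)
qed

section \<open>The absolute trace of a field with $3^h$ elements\<close>

locale ternary_field = field R for R (structure) +
  fixes h :: nat
  assumes h_ge: "2 \<le> h" and card_carrier: "card (carrier R) = 3 ^ h"
begin

lemma finite_carrier: "finite (carrier R)"
  using card_carrier card_gt_0_iff by fastforce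

lemma nonzero_pow: "x \<in> carrier R \<Longrightarrow> x [^] (n::nat) = \<zero> \<Longrightarrow> x = \<zero>"
  by (induction n) (auto simp: integral_iff)

text \<open>Characteristic 3 from the cardinality alone: the n-th power of 1+1+1 is 3^n times 1,
  which vanishes for n = \<open>h\<close> by Lagrange in the additive group, and a field has no
  nilpotents.\<close>

lemma triple_one: "\<one> \<oplus> (\<one> \<oplus> \<one>) = \<zero>"
proof -
  let ?t = "\<one> \<oplus> (\<one> \<oplus> \<one>)"
  have "[(3 ^ n :: nat)] \<cdot> \<one> = ?t [^] n" for n
  proof (induction n)
    case (Suc n)
    have "[(3 ^ Suc n :: nat)] \<cdot> \<one> = [(3 ^ n * 3 :: nat)] \<cdot> \<one>"
      by (simp add: mult.commute)
    also have "\<dots> = [(3 :: nat)] \<cdot> ([(3 ^ n :: nat)] \<cdot> \<one>)"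
      by (simp add: add.nat_pow_pow mult.commute)
    also have "\<dots> = ?t [^] n \<oplus> (?t [^] n \<oplus> ?t [^] n)"
      using Suc by (simp add: numeral_3_eq_3 add.nat_pow_Suc a_assoc)
    also have "\<dots> = ?t [^] Suc n"
      by (simp add: r_distr)
    finally show ?case .
  qed simp
  from this[of h] have "?t [^] h = [order (add_monoid R)] \<cdot> \<one>"
    by (simp add: order_def card_carrier)
  also have "\<dots> = \<zero>"
    using add.pow_order_eq_1[of \<one>] by simp
  finally show ?thesis
    using nonzero_pow[of ?t h] by simp
qed

lemma triple: "x \<in> carrier R \<Longrightarrow> x \<oplus> (x \<oplus> x) = \<zero>"
  using triple_one r_distr[of x] by (metis a_closed one_closed r_distr r_null r_one)

text \<open>This form removes three equal summands from the front of a longer sum, as they appear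
  after normalisation by associativity and commutativity.\<close>

lemma triple': "x \<in> carrier R \<Longrightarrow> y \<in> carrier R \<Longrightarrow> x \<oplus> (x \<oplus> (x \<oplus> y)) = y"
  using triple[of x] by (metis a_assoc a_closed l_zero)

lemma uminus_eq_double: "x \<in> carrier R \<Longrightarrow> \<ominus> x = x \<oplus> x"
  using triple[of x] by (metis a_closed minus_equality a_comm)

lemma cube_add:
  assumes "x \<in> carrier R" "y \<in> carrier R"
  shows "(x \<oplus> y) [^] (3::nat) = x [^] (3::nat) \<oplus> y [^] (3::nat)"
  using assms by (simp add: numeral_3_eq_3 l_distr r_distr a_ac m_ac triple triple')

lemma frobenius_add:
  assumes "x \<in> carrier R" "y \<in> carrier R"
  shows "(x \<oplus> y) [^] (3 ^ i :: nat) = x [^] (3 ^ i :: nat) \<oplus> y [^] (3 ^ i :: nat)"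
proof (induction i)
  case (Suc i)
  have "z [^] (3 ^ Suc i :: nat) = (z [^] (3 ^ i :: nat)) [^] (3 :: nat)" if "z \<in> carrier R" for z
    using that by (simp add: nat_pow_pow mult.commute)
  then show ?case
    using assms Suc by (simp add: cube_add)
qed (use assms in simp)

lemma frobenius_fixed:
  assumes "x \<in> carrier R"
  shows "x [^] (3 ^ h :: nat) = x"
proof (cases "x = \<zero>")
  case False
  interpret G: group "mult_of R" by (rule field_mult_group)
  have "x [^] (order (mult_of R)) = \<one>"
    using G.pow_order_eq_1[of x] assms False by (simp add: nat_pow_mult_of)
  then have "x [^] (3 ^ h - 1 :: nat) = \<one>"
    by (simp add: order_mult_of finite_carrier order_def[of R] card_carrier)
  then have "x [^] Suc (3 ^ h - 1 :: nat) = x"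
    using assms by (simp only: nat_pow_Suc l_one)
  moreover have "Suc (3 ^ h - 1) = 3 ^ h" by simp
  ultimately show ?thesis by metis
qed (simp add: nat_pow_zero)

abbreviation tr :: "'a \<Rightarrow> 'a" where "tr \<equiv> abs_trace R 3 h"

lemma tr_closed: "x \<in> carrier R \<Longrightarrow> tr x \<in> carrier R"
  by (simp add: abs_trace_def finsum_closed Pi_def)

lemma tr_add:
  assumes "x \<in> carrier R" "y \<in> carrier R"
  shows "tr (x \<oplus> y) = tr x \<oplus> tr y"
  using assms by (simp add: abs_trace_def frobenius_add finsum_addf Pi_def)

text \<open>Cubing is additive and moves each conjugate to the next one, while
  \<open>frobenius_fixed\<close> closes the cycle.\<close>

lemma tr_cube:
  assumes x: "x \<in> carrier R"
  shows "tr x [^] (3::nat) = tr x"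
proof -
  let ?f = "\<lambda>i::nat. x [^] (3 ^ i :: nat)"
  have closed: "?f \<in> A \<rightarrow> carrier R" for A using x by auto
  have cube: "(\<Oplus>i\<in>{..<n}. ?f i) [^] (3::nat) = (\<Oplus>i\<in>{..<n}. ?f (Suc i))" for n
  proof (induction n)
    case (Suc n)
    have "?f n [^] (3::nat) = ?f (Suc n)"
      using x by (simp add: nat_pow_pow mult.commute)
    then show ?case
      using x Suc by (simp add: lessThan_Suc cube_add Pi_def del: power_Suc)
  qed (simp add: nat_pow_zero)
  \<comment> \<open>The two sums differ only in their end terms; at \<open>n = h\<close> both end
    terms equal \<open>x\<close> and cancel. Adding them to opposite sides avoids
    subtraction.\<close>
  have shift: "(\<Oplus>i\<in>{..<n}. ?f (Suc i)) \<oplus> ?f 0 = (\<Oplus>i\<in>{..<n}. ?f i) \<oplus> ?f n" for n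
  proof (induction n)
    case (Suc n)
    have "(\<Oplus>i\<in>{..<Suc n}. ?f (Suc i)) \<oplus> ?f 0 = ?f (Suc n) \<oplus> ((\<Oplus>i\<in>{..<n}. ?f (Suc i)) \<oplus> ?f 0)"
      using x by (simp add: lessThan_Suc Pi_def a_assoc del: power_Suc)
    also have "\<dots> = (\<Oplus>i\<in>{..<Suc n}. ?f i) \<oplus> ?f (Suc n)"
      unfolding Suc using x by (simp add: lessThan_Suc Pi_def a_ac del: power_Suc)
    finally show ?case .
  qed (use x in simp)
  have "tr x [^] (3::nat) \<oplus> x = tr x \<oplus> x"
    using shift[of h] cube[of h] x by (simp add: abs_trace_def frobenius_fixed)
  then show ?thesis
    using x tr_closed[OF x] by simp
qed

text \<open>By \<open>tr_cube\<close> a trace is a root of y^3 - y = y (y - 1) (y + 1), and -1 is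
  1+1.\<close>

lemma tr_cases:
  assumes "x \<in> carrier R"
  obtains "tr x = \<zero>" | "tr x = \<one>" | "tr x = \<one> \<oplus> \<one>"
proof -
  let ?y = "tr x"
  have y: "?y \<in> carrier R" using assms by (rule tr_closed)
  have "?y \<otimes> ((?y \<ominus> \<one>) \<otimes> (?y \<oplus> \<one>)) = ?y [^] (3::nat) \<ominus> ?y"
    using y by (simp add: numeral_3_eq_3 l_distr r_distr a_ac m_ac minus_eq uminus_eq_double triple triple')
  also have "\<dots> = \<zero>"
    using y tr_cube[OF assms] by simp
  finally have "?y = \<zero> \<or> ?y \<ominus> \<one> = \<zero> \<or> ?y \<oplus> \<one> = \<zero>"
    using y by (simp add: integral_iff)
  moreover have "?y = \<one> \<oplus> \<one>" if "?y \<oplus> \<one> = \<zero>"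
    using that y minus_equality[of "?y" \<one>] by (simp add: uminus_eq_double)
  ultimately show ?thesis
    using y that by auto
qed

text \<open>With \<open>h = Suc n\<close> this is the trace as a polynomial of degree 3^(h-1), less
  than the number of field elements, so that \<open>tr_nonzero\<close> can count roots.\<close>

lemma trace_polynomial:
  "\<exists>f\<in>carrier (UP R). deg R f = 3 ^ n
     \<and> (\<forall>x\<in>carrier R. eval R R id x f = (\<Oplus>i\<in>{..<Suc n}. x [^] (3 ^ i :: nat)))"
proof -
  interpret UP: UP_domain R "UP R" by unfold_locales
  show ?thesis
  proof (induction n)
    case 0
    have "eval R R id x (monom (UP R) \<one> 1) = (\<Oplus>i\<in>{..<Suc 0}. x [^] (3 ^ i :: nat))"
      if "x \<in> carrier R" for x
      using that by (subst UP.evalRR_monom) (auto simp: lessThan_Suc)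
    moreover have "monom (UP R) \<one> 1 \<in> carrier (UP R)" "deg R (monom (UP R) \<one> 1) = 3 ^ 0"
      by simp_all
    ultimately show ?case by blast
  next
    case (Suc n)
    then obtain f where f: "f \<in> carrier (UP R)" "deg R f = 3 ^ n"
      and ev: "\<And>x. x \<in> carrier R \<Longrightarrow> eval R R id x f = (\<Oplus>i\<in>{..<Suc n}. x [^] (3 ^ i :: nat))"
      by blast
    let ?m = "monom (UP R) \<one> (3 ^ Suc n)"
    let ?g = "?m \<oplus>\<^bsub>UP R\<^esub> f"
    have lt: "deg R f < 3 ^ Suc n" using f(2) by simp
    have m: "?m \<in> carrier (UP R)" "deg R ?m = 3 ^ Suc n" by simp_all
    have "deg R ?g \<le> 3 ^ Suc n"
      using UP.deg_add[OF m(1) f(1)] m(2) lt by linarith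
    moreover have "3 ^ Suc n \<le> deg R ?g"
    proof (rule UP.deg_belowI)
      show "coeff (UP R) ?g (3 ^ Suc n) \<noteq> \<zero>"
        using f(1) m(1) UP.deg_aboveD[OF lt f(1)] by simp
    qed (use f m in simp)
    ultimately have "deg R ?g = 3 ^ Suc n" by simp
    moreover have "eval R R id x ?g = (\<Oplus>i\<in>{..<Suc (Suc n)}. x [^] (3 ^ i :: nat))"
      if "x \<in> carrier R" for x
      using that f m ev[OF that] by (simp add: UP.evalRR_simps lessThan_Suc Pi_def del: power_Suc)
    ultimately show ?case
      using UP.P.add.m_closed[OF m(1) f(1)] by blast
  qed
qed

lemma tr_nonzero: "\<exists>x\<in>carrier R. tr x \<noteq> \<zero>"
proof (rule ccontr)
  assume "\<not> ?thesis"
  then have all: "tr x = \<zero>" if "x \<in> carrier R" for x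
    using that by blast
  interpret UP: UP_domain R "UP R" by unfold_locales
  obtain n where n: "h = Suc n" using h_ge by (cases h) auto
  obtain f where f: "f \<in> carrier (UP R)" "deg R f = 3 ^ n"
    and ev: "\<And>x. x \<in> carrier R \<Longrightarrow> eval R R id x f = tr x"
    using trace_polynomial[of n] unfolding abs_trace_def n by blast
  have "f \<noteq> \<zero>\<^bsub>UP R\<^esub>" using f(2) by auto
  then have "card {a \<in> carrier R. eval R R id a f = \<zero>} \<le> 3 ^ n"
    using UP.roots_bound[OF f(1) _ finite_carrier] f(2) by simp
  moreover have "{a \<in> carrier R. eval R R id a f = \<zero>} = carrier R"
    using all ev by auto
  ultimately show False
    by (simp add: card_carrier n)
qed

end

section \<open>Equidistribution of traces\<close>

definition cube_root :: complex where
  "cube_root = Complex (- 1 / 2) (sqrt 3 / 2)"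

lemma cube_root_square: "cube_root * cube_root = Complex (- 1 / 2) (- sqrt 3 / 2)"
  by (simp add: cube_root_def complex_eq_iff)

lemma cube_root_cube: "cube_root * (cube_root * cube_root) = 1"
  by (subst cube_root_square) (simp add: cube_root_def complex_eq_iff)

lemma cmod_cube_root: "cmod cube_root = 1"
  by (simp add: cube_root_def cmod_def power2_eq_square)

lemma (in field) additive_character_sum:
  assumes \<psi>: "nontrivial_character (add_monoid R) \<psi>" and s: "s \<in> carrier R" "s \<noteq> \<zero>"
  shows "(\<Sum>x\<in>carrier R. \<psi> (x \<otimes> s)) = 0"
proof -
  obtain x where x: "x \<in> carrier R" "\<psi> x \<noteq> 1"
    using \<psi> by (auto simp: nontrivial_character_def)
  have "x \<otimes> inv s \<otimes> s = x" "x \<otimes> inv s \<in> carrier R"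
    using x s by (simp_all add: m_assoc field_Units)
  then have "nontrivial_character (add_monoid R) (\<lambda>x. \<psi> (x \<otimes> s))"
    using \<psi> s x unfolding nontrivial_character_def is_character_def
    by (auto simp: l_distr intro!: bexI[of _ "x \<otimes> inv s"])
  from character_sum_eq_0[OF add.is_group this] show ?thesis
    by simp
qed

lemma nontrivial_character_zero:
  assumes "abelian_group R" "nontrivial_character (add_monoid R) \<psi>"
  shows "\<psi> \<zero>\<^bsub>R\<^esub> = 1"
proof -
  interpret abelian_group R by fact
  have "\<psi> (\<zero>\<^bsub>R\<^esub> \<oplus>\<^bsub>R\<^esub> \<zero>\<^bsub>R\<^esub>) = \<psi> \<zero>\<^bsub>R\<^esub> * \<psi> \<zero>\<^bsub>R\<^esub>" "cmod (\<psi> \<zero>\<^bsub>R\<^esub>) = 1"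
    using assms(2) unfolding nontrivial_character_def is_character_def by (auto simp del: r_zero l_zero)
  then show ?thesis by auto
qed

lemma (in field) additive_character_diff:
  assumes \<psi>: "nontrivial_character (add_monoid R) \<psi>" and x: "x \<in> carrier R" "y \<in> carrier R"
  shows "\<psi> (x \<ominus> y) = \<psi> x * cnj (\<psi> y)"
proof -
  have char: "cmod (\<psi> u) = 1" "\<psi> (u \<oplus> v) = \<psi> u * \<psi> v" if "u \<in> carrier R" "v \<in> carrier R" for u v
    using \<psi> that unfolding nontrivial_character_def is_character_def by auto
  have "\<psi> (x \<ominus> y) * \<psi> y = \<psi> (x \<ominus> y \<oplus> y)"
    using x by (simp add: char)
  also have "x \<ominus> y \<oplus> y = x"
    using x by (simp add: minus_eq a_assoc l_neg)
  finally have "\<psi> x * cnj (\<psi> y) = \<psi> (x \<ominus> y) * (\<psi> y * cnj (\<psi> y))"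
    by (simp add: mult.assoc)
  also have "\<psi> y * cnj (\<psi> y) = 1"
    using char(1)[OF x(2) x(2)] complex_norm_square[of "\<psi> y"] by simp
  finally show ?thesis by simp
qed

section \<open>Integer trace codes and the canonical additive character\<close>

context ternary_field
begin

text \<open>Coding the trace by an integer turns sums over trace values into sums over {0,1,2} with
  arithmetic mod 3, which can be evaluated outright. On the carrier the value 2 stands for trace
  1+1, by \<open>tr_cases\<close>.\<close>

definition T :: "'a \<Rightarrow> int" where
  "T x = (if tr x = \<zero> then 0 else if tr x = \<one> then 1 else 2)"

lemma two_neq: "\<one> \<oplus> \<one> \<noteq> \<zero>" "\<one> \<oplus> \<one> \<noteq> \<one>" "\<zero> \<noteq> \<one> \<oplus> \<one>" "\<one> \<noteq> \<one> \<oplus> \<one>"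
proof -
  show *: "\<one> \<oplus> \<one> \<noteq> \<zero>" using triple_one by auto
  show **: "\<one> \<oplus> \<one> \<noteq> \<one>" using add.l_cancel_one'[of \<one> \<one>] by auto
  from * ** show "\<zero> \<noteq> \<one> \<oplus> \<one>" "\<one> \<noteq> \<one> \<oplus> \<one>" by metis+
qed

lemma T_cases: "T x = 0 \<or> T x = 1 \<or> T x = 2"
  by (simp add: T_def)

lemma T_add:
  assumes "x \<in> carrier R" "y \<in> carrier R"
  shows "T (x \<oplus> y) = (T x + T y) mod 3"
proof -
  have "\<one> \<oplus> \<one> \<oplus> \<one> = \<zero>" "\<one> \<oplus> \<one> \<oplus> (\<one> \<oplus> \<one>) = \<one>"
    using triple_one triple'[of \<one> \<one>] by (simp_all add: a_assoc)
  then show ?thesis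
    using assms two_neq triple_one
    by (cases rule: tr_cases[OF assms(1)]; cases rule: tr_cases[OF assms(2)])
      (simp_all add: T_def tr_add)
qed

lemma T_zero [simp]: "T \<zero> = 0"
  using T_add[of \<zero> \<zero>] T_cases[of \<zero>] by auto

lemma T_uminus: "x \<in> carrier R \<Longrightarrow> T (\<ominus> x) = (2 * T x) mod 3"
  by (simp add: uminus_eq_double T_add)

lemma T_nonzero: "\<exists>x\<in>carrier R. T x \<noteq> 0"
  using tr_nonzero by (auto simp: T_def)

text \<open>The character exp(2 pi i Tr(x) / 3). It serves to prove equidistribution and is
  unrelated to the arbitrary character in the theorem.\<close>

definition \<Psi> :: "'a \<Rightarrow> complex" where
  "\<Psi> x = cube_root ^ nat (T x)"

lemma \<Psi>_add:
  assumes "x \<in> carrier R" "y \<in> carrier R"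
  shows "\<Psi> (x \<oplus> y) = \<Psi> x * \<Psi> y"
  using T_cases[of x] T_cases[of y] cube_root_cube
  by (auto simp: \<Psi>_def T_add[OF assms] power2_eq_square mult.assoc)

lemma \<Psi>_eq_1_iff: "\<Psi> x = 1 \<longleftrightarrow> T x = 0"
  using T_cases[of x]
  by (auto simp: \<Psi>_def power2_eq_square cube_root_square) (auto simp: cube_root_def complex_eq_iff)

lemma \<Psi>_nontrivial: "nontrivial_character (add_monoid R) \<Psi>"
  using T_nonzero
  by (auto simp: nontrivial_character_def is_character_def \<Psi>_eq_1_iff \<Psi>_add)
    (simp add: \<Psi>_def norm_power cmod_cube_root)

text \<open>Restricted to \<open>S\<close>, the map s to \<open>\<Psi> (m \<otimes> s)\<close> is a
  character of \<open>S\<close>: either constantly 1, or nontrivial and then of sum zero.\<close>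

lemma \<Psi>_subgroup_sum:
  assumes S: "subgroup S (add_monoid R)" and m: "m \<in> carrier R"
  shows "(\<Sum>s\<in>S. \<Psi> (m \<otimes> s)) = (if \<forall>s\<in>S. T (m \<otimes> s) = 0 then of_nat (card S) else 0)"
proof (cases "\<forall>s\<in>S. T (m \<otimes> s) = 0")
  case True
  then have "\<Psi> (m \<otimes> s) = 1" if "s \<in> S" for s
    using that by (simp add: \<Psi>_eq_1_iff)
  with True show ?thesis by simp
next
  case False
  have sub: "S \<subseteq> carrier R" using subgroup.subset[OF S] by simp
  let ?G = "add_monoid R\<lparr>carrier := S\<rparr>"
  have "nontrivial_character ?G (\<lambda>s. \<Psi> (m \<otimes> s))"
    using False m sub \<Psi>_nontrivial
    unfolding nontrivial_character_def is_character_def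
    by (auto simp: \<Psi>_eq_1_iff r_distr \<Psi>_add subset_iff)
  from character_sum_eq_0[OF subgroup.subgroup_is_group[OF S add.is_group] this]
  show ?thesis using False by (subst if_not_P) auto
qed

text \<open>
  If \<open>T (m \<otimes> u) = 0\<close> for all \<open>m\<close> in the annihilator \<open>P\<close> of \<open>S\<close>, then summing
  \<open>\<Psi> (m \<otimes> (s \<oplus> u))\<close> over \<open>m\<close> and \<open>s \<in> S\<close> first in one and then in the other order
  gives both \<open>0\<close> and \<open>card P * card S\<close>.
\<close>

lemma separating_shift:
  assumes S: "subgroup S (add_monoid R)" and u: "u \<in> carrier R" "u \<notin> S"
  obtains m where "m \<in> carrier R" "\<And>s. s \<in> S \<Longrightarrow> T (m \<otimes> s) = 0" "T (m \<otimes> u) = 1"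
proof -
  have sub: "S \<subseteq> carrier R" using subgroup.subset[OF S] by simp
  define P where "P = {m \<in> carrier R. \<forall>s\<in>S. T (m \<otimes> s) = 0}"
  have "\<exists>m\<in>P. T (m \<otimes> u) \<noteq> 0"
  proof (rule ccontr)
    assume "\<not> ?thesis"
    then have triv: "\<Psi> (m \<otimes> u) = 1" if "m \<in> P" for m
      using that by (simp add: \<Psi>_eq_1_iff)
    have "(\<Sum>m\<in>carrier R. \<Psi> (m \<otimes> (s \<oplus> u))) = 0" if s: "s \<in> S" for s
    proof (rule additive_character_sum[OF \<Psi>_nontrivial])
      show "s \<oplus> u \<noteq> \<zero>"
      proof
        assume "s \<oplus> u = \<zero>"
        then have "u = \<ominus> s"
          using s sub u by (metis a_comm minus_equality subsetD)
        with subgroup.m_inv_closed[OF S s] u show False by (simp add: a_inv_def)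
      qed
    qed (use s sub u in auto)
    then have "0 = (\<Sum>s\<in>S. \<Sum>m\<in>carrier R. \<Psi> (m \<otimes> (s \<oplus> u)))"
      by simp
    also have "\<dots> = (\<Sum>m\<in>carrier R. \<Sum>s\<in>S. \<Psi> (m \<otimes> s) * \<Psi> (m \<otimes> u))"
      by (subst sum.swap, intro sum.cong refl) (use sub u in \<open>auto simp: r_distr \<Psi>_add\<close>)
    also have "\<dots> = (\<Sum>m\<in>carrier R. if m \<in> P then of_nat (card S) else 0)"
      by (intro sum.cong refl) (auto simp: sum_distrib_right[symmetric] \<Psi>_subgroup_sum[OF S] P_def triv)
    also have "\<dots> = of_nat (card P * card S)"
      using finite_carrier by (simp add: sum.If_cases P_def Int_def)
    finally have "card P * card S = 0"
      by (metis of_nat_eq_0_iff)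
    moreover have "finite P" "\<zero> \<in> P"
      using finite_carrier sub by (auto simp: P_def)
    moreover have "finite S" "\<zero> \<in> S"
      using finite_carrier sub finite_subset subgroup.one_closed[OF S] by auto
    ultimately show False
      by auto
  qed
  then obtain m where m: "m \<in> P" "T (m \<otimes> u) = 1 \<or> T (m \<otimes> u) = 2"
    using T_cases by metis
  show ?thesis
  proof (cases "T (m \<otimes> u) = 1")
    case True
    with m that show ?thesis by (auto simp: P_def)
  next
    case False
    with m sub u show ?thesis
      by (intro that[of "\<ominus> m"]) (auto simp: P_def l_minus T_uminus subset_iff)
  qed
qed

text \<open>Translating \<open>m\<close> by \<open>c\<close> raises the trace of
  \<open>m \<otimes> u\<close> by 1 and leaves \<open>F\<close> alone, so the sums with the trace
  shifted by 0, 1 and 2 coincide. Added up, they run through all three values.\<close>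

lemma shift_average:
  fixes F :: "'a \<Rightarrow> int \<Rightarrow> real"
  assumes c: "c \<in> carrier R" "u \<in> carrier R" "T (c \<otimes> u) = 1"
    and inv: "\<And>m x. m \<in> carrier R \<Longrightarrow> F (m \<oplus> c) x = F m x"
  shows "3 * (\<Sum>m\<in>carrier R. F m (T (m \<otimes> u))) = (\<Sum>m\<in>carrier R. \<Sum>x\<in>{0,1,2}. F m x)"
proof -
  let ?S = "\<lambda>i. \<Sum>m\<in>carrier R. F m ((T (m \<otimes> u) + i) mod 3)"
  have bij: "bij_betw (\<lambda>m. m \<oplus> c) (carrier R) (carrier R)"
    by (rule bij_betw_byWitness[of _ "\<lambda>m. m \<ominus> c"]) (use c in \<open>auto simp: minus_eq a_assoc l_neg r_neg\<close>)
  have step: "?S i = ?S (i + 1)" for i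
  proof -
    have "?S i = (\<Sum>m\<in>carrier R. F (m \<oplus> c) ((T ((m \<oplus> c) \<otimes> u) + i) mod 3))"
      by (rule sum.reindex_bij_betw[OF bij, symmetric])
    also have "\<dots> = ?S (i + 1)"
      using c by (intro sum.cong refl) (simp add: inv l_distr T_add mod_simps algebra_simps)
    finally show ?thesis .
  qed
  have "3 * ?S 0 = ?S 0 + ?S 1 + ?S 2"
    using step[of 0] step[of 1] by simp
  also have "\<dots> = (\<Sum>m\<in>carrier R. \<Sum>x\<in>{0,1,2}. F m x)"
    unfolding sum.distrib[symmetric]
  proof (intro sum.cong refl)
    fix m
    show "F m ((T (m \<otimes> u) + 0) mod 3) + F m ((T (m \<otimes> u) + 1) mod 3) + F m ((T (m \<otimes> u) + 2) mod 3)
      = (\<Sum>x\<in>{0,1,2}. F m x)"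
      using T_cases[of "m \<otimes> u"] by auto
  qed
  moreover have "?S 0 = (\<Sum>m\<in>carrier R. F m (T (m \<otimes> u)))"
  proof (intro sum.cong refl)
    fix m
    show "F m ((T (m \<otimes> u) + 0) mod 3) = F m (T (m \<otimes> u))"
      using T_cases[of "m \<otimes> u"] by auto
  qed
  ultimately show ?thesis by simp
qed

abbreviation F3 :: "'a set" where "F3 \<equiv> {\<zero>, \<one>, \<one> \<oplus> \<one>}"

lemma F3_subgroup: "subgroup F3 (add_monoid R)"
proof (rule add.subgroupI)
  have *: "\<one> \<oplus> \<one> \<oplus> \<one> = \<zero>" "\<one> \<oplus> \<one> \<oplus> (\<one> \<oplus> \<one>) = \<one>"
    using triple_one triple'[of \<one> \<one>] by (simp_all add: a_assoc)
  show "a \<oplus> b \<in> F3" if "a \<in> F3" "b \<in> F3" for a b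
    using that * triple_one by auto
  show "\<ominus> a \<in> F3" if "a \<in> F3" for a
    using that * by (auto simp: uminus_eq_double)
qed auto

text \<open>The F_3-span of 1 and t. For t outside \<open>F3\<close>,
  \<open>u \<notin> span t\<close> says that 1, t, u are linearly independent over F_3.\<close>

definition span :: "'a \<Rightarrow> 'a set" where
  "span t = {i \<oplus> j \<otimes> t | i j. i \<in> F3 \<and> j \<in> F3}"

lemma span_subgroup:
  assumes t: "t \<in> carrier R"
  shows "subgroup (span t) (add_monoid R)"
proof (rule add.subgroupI)
  have F3: "F3 \<subseteq> carrier R" by auto
  show "span t \<subseteq> carrier R"
    using F3 t by (auto simp: span_def)
  show "span t \<noteq> {}" by (auto simp: span_def)
  show "a \<oplus> b \<in> span t" if ab: "a \<in> span t" "b \<in> span t" for a b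
  proof -
    obtain i j k l where ij: "a = i \<oplus> j \<otimes> t" "i \<in> F3" "j \<in> F3" and kl: "b = k \<oplus> l \<otimes> t" "k \<in> F3" "l \<in> F3"
      using ab by (auto simp only: span_def mem_Collect_eq)
    have in_carrier: "i \<in> carrier R" "j \<in> carrier R" "k \<in> carrier R" "l \<in> carrier R"
      using F3 ij kl by blast+
    have "a \<oplus> b = (i \<oplus> k) \<oplus> (j \<oplus> l) \<otimes> t"
      using t in_carrier by (simp add: ij kl l_distr a_ac)
    moreover have "i \<oplus> k \<in> F3" "j \<oplus> l \<in> F3"
      using subgroup.m_closed[OF F3_subgroup] ij kl by (simp_all only: monoid.simps)
    ultimately show ?thesis
      by (auto simp only: span_def mem_Collect_eq)
  qed
  show "\<ominus> a \<in> span t" if a: "a \<in> span t" for a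
  proof -
    obtain i j where ij: "a = i \<oplus> j \<otimes> t" "i \<in> F3" "j \<in> F3"
      using a by (auto simp only: span_def mem_Collect_eq)
    have in_carrier: "i \<in> carrier R" "j \<in> carrier R"
      using F3 ij by blast+
    have "\<ominus> a = \<ominus> i \<oplus> \<ominus> j \<otimes> t"
      using t in_carrier by (simp add: ij l_minus minus_add)
    moreover have "\<ominus> i \<in> F3" "\<ominus> j \<in> F3"
      using subgroup.m_inv_closed[OF F3_subgroup] ij by (simp_all only: a_inv_def)
    ultimately show ?thesis
      by (auto simp only: span_def mem_Collect_eq)
  qed
qed

lemma one_in_span: "t \<in> carrier R \<Longrightarrow> \<one> \<in> span t"
proof -
  assume "t \<in> carrier R"
  then have "\<one> = \<one> \<oplus> \<zero> \<otimes> t" by simp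
  then show ?thesis unfolding span_def by blast
qed

lemma self_in_span: "t \<in> carrier R \<Longrightarrow> t \<in> span t"
proof -
  assume "t \<in> carrier R"
  then have "t = \<zero> \<oplus> \<one> \<otimes> t" by simp
  then show ?thesis unfolding span_def by blast
qed

text \<open>The shift is separated from the trivial subgroup only. The two analogues below separate
  it from \<open>F3\<close> and from \<open>span t\<close>, which freezes the earlier traces while
  the last one is averaged out.\<close>

lemma equidistribution1:
  assumes u: "u \<in> carrier R" "u \<noteq> \<zero>"
  shows "(\<Sum>m\<in>carrier R. f (T (m \<otimes> u))) = 3 ^ h / 3 * (\<Sum>x\<in>{0,1,2}. f x :: real)"
proof -
  obtain c where "c \<in> carrier R" "T (c \<otimes> u) = 1"
    using separating_shift[OF add.triv_subgroup, of u] u by auto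
  from shift_average[OF this(1) u(1) this(2), of "\<lambda>m. f"] show ?thesis
    by (simp add: card_carrier field_simps)
qed

lemma equidistribution2:
  assumes u: "u \<in> carrier R" "u \<notin> F3"
  shows "(\<Sum>m\<in>carrier R. f (T m) (T (m \<otimes> u)))
    = 3 ^ h / 9 * (\<Sum>x\<in>{0,1,2}. \<Sum>y\<in>{0,1,2}. f x y :: real)"
proof -
  obtain c where c: "c \<in> carrier R" "\<And>s. s \<in> F3 \<Longrightarrow> T (c \<otimes> s) = 0" "T (c \<otimes> u) = 1"
    using separating_shift[OF F3_subgroup u] by auto
  have "T c = 0"
    using c(2)[of \<one>] c(1) by simp
  then have "f (T (m \<oplus> c)) x = f (T m) x" if "m \<in> carrier R" for m x
    using that c(1) T_cases[of m] by (auto simp: T_add)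
  from shift_average[OF c(1) u(1) c(3), of "\<lambda>m. f (T m)", OF this]
  \<comment> \<open>The remaining trace is written with a factor 1 so that the one-variable lemma
    applies.\<close>
  have "3 * (\<Sum>m\<in>carrier R. f (T m) (T (m \<otimes> u))) = (\<Sum>m\<in>carrier R. \<Sum>y\<in>{0,1,2}. f (T (m \<otimes> \<one>)) y)"
    by simp
  also have "\<dots> = 3 ^ h / 3 * (\<Sum>x\<in>{0,1,2}. \<Sum>y\<in>{0,1,2}. f x y)"
    by (rule equidistribution1) auto
  finally show ?thesis
    by (simp add: field_simps)
qed

lemma equidistribution3:
  assumes t: "t \<in> carrier R" "t \<notin> F3" and u: "u \<in> carrier R" "u \<notin> span t"
  shows "(\<Sum>m\<in>carrier R. f (T m) (T (m \<otimes> t)) (T (m \<otimes> u)))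
    = 3 ^ h / 27 * (\<Sum>x\<in>{0,1,2}. \<Sum>y\<in>{0,1,2}. \<Sum>z\<in>{0,1,2}. f x y z :: real)"
proof -
  obtain c where c: "c \<in> carrier R" "\<And>s. s \<in> span t \<Longrightarrow> T (c \<otimes> s) = 0" "T (c \<otimes> u) = 1"
    using separating_shift[OF span_subgroup[OF t(1)] u] by auto
  have "T c = 0" "T (c \<otimes> t) = 0"
    using c(2)[OF one_in_span[OF t(1)]] c(2)[OF self_in_span[OF t(1)]] c(1) by simp_all
  then have "f (T (m \<oplus> c)) (T ((m \<oplus> c) \<otimes> t)) x = f (T m) (T (m \<otimes> t)) x" if "m \<in> carrier R" for m x
    using that c(1) t T_cases[of m] T_cases[of "m \<otimes> t"] by (auto simp: T_add l_distr)
  from shift_average[OF c(1) u(1) c(3), of "\<lambda>m. f (T m) (T (m \<otimes> t))", OF this]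
  have "3 * (\<Sum>m\<in>carrier R. f (T m) (T (m \<otimes> t)) (T (m \<otimes> u)))
      = (\<Sum>m\<in>carrier R. \<Sum>z\<in>{0,1,2}. f (T m) (T (m \<otimes> t)) z)"
    by simp
  also have "\<dots> = 3 ^ h / 9 * (\<Sum>x\<in>{0,1,2}. \<Sum>y\<in>{0,1,2}. \<Sum>z\<in>{0,1,2}. f x y z)"
    by (rule equidistribution2[OF t])
  finally show ?thesis
    by (simp add: field_simps)
qed

end

section \<open>Gram matrices\<close>

definition idx_v :: "int \<Rightarrow> real" where
  "idx_v x = (if x = 0 then 1 else if x = 1 then r_const else - 1 - r_const)"

text \<open>The radicand 9 - 6 sqrt 2 is 1 + 4 eta, the discriminant of r^2 + r = eta; it has to be
  nonnegative for the square root to be genuine.\<close>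

lemma r_const_quadratic: "r_const\<^sup>2 + r_const = eta_const"
proof -
  have "sqrt 2 \<le> 3/2"
    by (rule real_le_lsqrt) (simp_all add: power2_eq_square)
  then have "0 \<le> 9 - 6 * sqrt 2" by simp
  then show ?thesis
    by (simp add: r_const_def eta_const_def power2_eq_square field_simps)
qed

lemma idx_v_simps [simp]: "idx_v 0 = 1" "idx_v 1 = r_const" "idx_v 2 = - 1 - r_const"
  by (simp_all add: idx_v_def)

definition \<kappa> :: "nat \<Rightarrow> real" where
  "\<kappa> q = real q * (sqrt 2 - 1)\<^sup>2"

lemma \<kappa>_r_const: "\<kappa> q = real q / 3 * (1 + 4 * r_const + 4 * r_const\<^sup>2)"
proof -
  have "3 * (sqrt 2 - 1)\<^sup>2 = 1 + 4 * eta_const"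
    by (simp add: eta_const_def power2_diff)
  then have *: "(sqrt 2 - 1)\<^sup>2 = (1 + 4 * (r_const\<^sup>2 + r_const)) / 3"
    unfolding r_const_quadratic by simp
  show ?thesis
    unfolding \<kappa>_def * by (simp add: field_simps)
qed

text \<open>This is eta^2 = 4 eta + 1/2 after the substitution eta = r^2 + r.\<close>

lemma r_const_quartic: "r_const ^ 4 = 1 / 2 + 4 * r_const + 3 * r_const\<^sup>2 - 2 * r_const ^ 3"
proof -
  have "eta_const\<^sup>2 = 4 * eta_const + 1 / 2"
    by (simp add: eta_const_def power2_diff power_mult_distrib power_divide)
  then show ?thesis
    unfolding r_const_quadratic[symmetric] by (simp add: power2_eq_square eval_nat_numeral algebra_simps)
qed

text \<open>The quartic in the nested-product shape left by expanding powers; with it, degree four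
  terms in the Gram entries reduce to degree three.\<close>

lemma r_const_reduce:
  "r_const * (r_const * (r_const * r_const))
    = 1 / 2 + 4 * r_const + 3 * (r_const * r_const) - 2 * (r_const * (r_const * r_const))"
  using r_const_quartic by (simp add: eval_nat_numeral algebra_simps)

context ternary_field
begin

text \<open>Replacing \<open>l\<close> by \<open>l \<otimes> inv m\<close> leaves only the ratio s =
  m'/m. The cases are s = 1, s = -1, and 1, s independent over F_3.\<close>

lemma T_sum_gram:
  assumes m: "m \<in> carrier R" "m' \<in> carrier R" "m \<noteq> \<zero>" "m' \<noteq> \<zero>"
  shows "(\<Sum>l\<in>carrier R. (idx_v (T (l \<otimes> m)))\<^sup>2 * (idx_v (T (l \<otimes> m')))\<^sup>2)
    = \<kappa> (3 ^ h) * ((if m = m' then 1 else 0) + 2)"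
proof -
  let ?s = "inv m \<otimes> m'"
  have im: "inv m \<in> carrier R" "m \<otimes> inv m = \<one>" "inv m \<otimes> m = \<one>"
    using m by (simp_all add: field_Units)
  have s: "?s \<in> carrier R" "m \<otimes> ?s = m'"
    using m im by (simp_all add: m_assoc[symmetric])
  then have s_neq: "?s \<noteq> \<zero>" and s_one: "?s = \<one> \<longleftrightarrow> m = m'"
    using m im by auto
  have bij: "bij_betw (\<lambda>l. l \<otimes> m) (carrier R) (carrier R)"
    by (rule bij_betw_byWitness[of _ "\<lambda>l. l \<otimes> inv m"]) (use m im in \<open>auto simp: m_assoc\<close>)
  have "(\<Sum>l\<in>carrier R. (idx_v (T (l \<otimes> m)))\<^sup>2 * (idx_v (T (l \<otimes> m')))\<^sup>2)
      = (\<Sum>l\<in>carrier R. (idx_v (T (l \<otimes> m)))\<^sup>2 * (idx_v (T (l \<otimes> m \<otimes> ?s)))\<^sup>2)"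
    using m s by (intro sum.cong refl) (simp add: m_assoc del: Units_inv_closed)
  also have "\<dots> = (\<Sum>l\<in>carrier R. (idx_v (T l))\<^sup>2 * (idx_v (T (l \<otimes> ?s)))\<^sup>2)"
    by (rule sum.reindex_bij_betw[OF bij])
  also have "\<dots> = \<kappa> (3 ^ h) * ((if m = m' then 1 else 0) + 2)"
  proof (cases "?s \<in> F3")
    case False
    then have "m \<noteq> m'" using s_one by auto
    have "(\<Sum>x\<in>{0,1,2}. \<Sum>y\<in>{0,1,2}. (idx_v x)\<^sup>2 * (idx_v y)\<^sup>2)
        = 6 * (1 + 4 * r_const + 4 * r_const\<^sup>2)"
      using r_const_reduce by (simp add: eval_nat_numeral algebra_simps)
    with \<open>m \<noteq> m'\<close> show ?thesis
      by (simp only: equidistribution2[OF s(1) False, of "\<lambda>x y. (idx_v x)\<^sup>2 * (idx_v y)\<^sup>2"]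
          \<kappa>_r_const) simp
  next
    case True
    then consider "?s = \<one>" | "?s = \<one> \<oplus> \<one>" using s_neq by auto
    then show ?thesis
    proof cases
      case 1
      then have "m = m'" using s_one by blast
      moreover have "(\<Sum>l\<in>carrier R. (idx_v (T l))\<^sup>2 * (idx_v (T (l \<otimes> ?s)))\<^sup>2)
          = (\<Sum>l\<in>carrier R. (idx_v (T (l \<otimes> \<one>))) ^ 4)"
        unfolding 1 by (intro sum.cong refl) (simp add: eval_nat_numeral)
      moreover have "(\<Sum>x\<in>{0,1,2}. idx_v x ^ 4) = 3 * (1 + 4 * r_const + 4 * r_const\<^sup>2)"
        using r_const_reduce by (simp add: eval_nat_numeral algebra_simps)
      ultimately show ?thesis
        by (simp only: equidistribution1[OF one_closed one_not_zero, of "\<lambda>x. idx_v x ^ 4"] \<kappa>_r_const) simp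
    next
      \<comment> \<open>The trace of -l is twice that of l, so r is paired with -1-r. This is the
        entry that dictates the value of r.\<close>
      case 2
      then have "m \<noteq> m'" using s_one two_neq by auto
      moreover have "(\<Sum>l\<in>carrier R. (idx_v (T l))\<^sup>2 * (idx_v (T (l \<otimes> ?s)))\<^sup>2)
          = (\<Sum>l\<in>carrier R. (idx_v (T (l \<otimes> \<one>)))\<^sup>2 * (idx_v ((2 * T (l \<otimes> \<one>)) mod 3))\<^sup>2)"
        unfolding 2 by (intro sum.cong refl) (simp add: r_distr T_add)
      moreover have "(\<Sum>x\<in>{0,1,2}. (idx_v x)\<^sup>2 * (idx_v ((2 * x) mod 3))\<^sup>2)
          = 2 * (1 + 4 * r_const + 4 * r_const\<^sup>2)"
        using r_const_reduce by (simp add: eval_nat_numeral algebra_simps)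
      ultimately show ?thesis
        by (simp only: equidistribution1[OF one_closed one_not_zero,
              of "\<lambda>x. (idx_v x)\<^sup>2 * (idx_v ((2 * x) mod 3))\<^sup>2"] \<kappa>_r_const) simp
    qed
  qed
  finally show ?thesis .
qed

text \<open>The entry of \<open>N_const (3 ^ h) * B_mat R (phi_vec R h)\<close> at \<open>(m, t)\<close> is \<open>pair_v (T m) (T (m \<otimes> t))\<close>.\<close>

definition pair_v :: "int \<Rightarrow> int \<Rightarrow> real" where
  "pair_v y x = idx_v x * idx_v ((x + y) mod 3)"

text \<open>Here t' = i + j t with scalars in F_3 and j nonzero, so the trace of m t' is a function
  of those of m and m t. Six pairs (i, j) remain, with (0, 1) the diagonal.\<close>

lemma T_pair_gram_dependent:
  assumes t: "t \<in> carrier R" "t \<notin> F3" and ij: "i \<in> {0,1,2}" "j \<in> {1,2}"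
    and t': "\<And>m. m \<in> carrier R \<Longrightarrow> T (m \<otimes> t') = (i * T m + j * T (m \<otimes> t)) mod 3"
  shows "(\<Sum>m\<in>carrier R. pair_v (T m) (T (m \<otimes> t)) * pair_v (T m) (T (m \<otimes> t')))
    = \<kappa> (3 ^ h) * ((if i = 0 \<and> j = 1 then 1 else 0) + 1)"
proof -
  have "(\<Sum>m\<in>carrier R. pair_v (T m) (T (m \<otimes> t)) * pair_v (T m) (T (m \<otimes> t')))
    = (\<Sum>m\<in>carrier R. pair_v (T m) (T (m \<otimes> t)) * pair_v (T m) ((i * T m + j * T (m \<otimes> t)) mod 3))"
    by (intro sum.cong refl) (simp add: t')
  also have "\<dots> = 3 ^ h / 9 * (\<Sum>y\<in>{0,1,2}. \<Sum>x\<in>{0,1,2}. pair_v y x * pair_v y ((i * y + j * x) mod 3))"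
    by (rule equidistribution2[OF t])
  also have "(\<Sum>y\<in>{0,1,2}. \<Sum>x\<in>{0,1,2}. pair_v y x * pair_v y ((i * y + j * x) mod 3))
    = 3 * (1 + 4 * r_const + 4 * r_const\<^sup>2) * ((if i = 0 \<and> j = 1 then 1 else 0) + 1)"
    using ij r_const_reduce
    by (elim insertE emptyE; simp add: pair_v_def power2_eq_square algebra_simps)
  also have "3 ^ h / 9 * \<dots> = \<kappa> (3 ^ h) * ((if i = 0 \<and> j = 1 then 1 else 0) + 1)"
    by (simp add: \<kappa>_r_const)
  finally show ?thesis .
qed

text \<open>Turns a scalar of the prime field into the integer acting on trace codes; the
  equivalences for 0 and 1 carry case distinctions across.\<close>

lemma F3_scalar:
  assumes "i \<in> F3"
  obtains k where "k \<in> {0,1,2}" "k = 0 \<longleftrightarrow> i = \<zero>" "k = 1 \<longleftrightarrow> i = \<one>"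
    "\<forall>m\<in>carrier R. T (m \<otimes> i) = (k * T m) mod 3"
proof -
  have T_mod: "T m mod 3 = T m" for m
    using T_cases[of m] by auto
  from assms consider "i = \<zero>" | "i = \<one>" | "i = \<one> \<oplus> \<one>" by blast
  then show ?thesis
  proof cases
    case 1
    then show ?thesis by (intro that[of 0]) auto
  next
    case 2
    then show ?thesis by (intro that[of 1]) (auto simp: T_mod)
  next
    case 3
    then show ?thesis using two_neq by (intro that[of 2]) (auto simp: r_distr T_add)
  qed
qed

lemma T_pair_gram_one:
  assumes t: "t \<in> carrier R" "t \<notin> F3"
  shows "(\<Sum>m\<in>carrier R. pair_v (T m) (T (m \<otimes> \<one>)) * pair_v (T m) (T (m \<otimes> t))) = \<kappa> (3 ^ h)"
proof -
  have "(\<Sum>m\<in>carrier R. pair_v (T m) (T (m \<otimes> \<one>)) * pair_v (T m) (T (m \<otimes> t)))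
      = (\<Sum>m\<in>carrier R. pair_v (T m) (T m) * pair_v (T m) (T (m \<otimes> t)))"
    by (intro sum.cong refl) simp
  also have "\<dots> = 3 ^ h / 9 * (\<Sum>y\<in>{0,1,2}. \<Sum>x\<in>{0,1,2}. pair_v y y * pair_v y x)"
    by (rule equidistribution2[OF t])
  also have "(\<Sum>y\<in>{0,1,2}. \<Sum>x\<in>{0,1,2}. pair_v y y * pair_v y x)
      = 3 * (1 + 4 * r_const + 4 * r_const\<^sup>2)"
    using r_const_reduce by (simp add: pair_v_def power2_eq_square algebra_simps)
  also have "3 ^ h / 9 * \<dots> = \<kappa> (3 ^ h)"
    by (simp add: \<kappa>_r_const)
  finally show ?thesis .
qed

text \<open>The cases follow the dimension over F_3 of the span of 1, t, t'. Only 1 remains of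
  \<open>F3\<close> once 0 and -1 are excluded.\<close>

lemma T_pair_gram:
  assumes t: "t \<in> carrier R" "t \<notin> {\<zero>, \<ominus> \<one>}" and t': "t' \<in> carrier R" "t' \<notin> {\<zero>, \<ominus> \<one>}"
  shows "(\<Sum>m\<in>carrier R. pair_v (T m) (T (m \<otimes> t)) * pair_v (T m) (T (m \<otimes> t')))
    = \<kappa> (3 ^ h) * ((if t = t' then 1 else 0) + 1)"
proof (cases "t \<in> F3")
  case True
  then have t1: "t = \<one>" using t by (auto simp: uminus_eq_double)
  show ?thesis
  proof (cases "t' \<in> F3")
    case True
    then have t1': "t' = \<one>" using t' by (auto simp: uminus_eq_double)
    have "(\<Sum>m\<in>carrier R. pair_v (T m) (T (m \<otimes> t)) * pair_v (T m) (T (m \<otimes> t')))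
        = (\<Sum>m\<in>carrier R. (pair_v (T (m \<otimes> \<one>)) (T (m \<otimes> \<one>)))\<^sup>2)"
      unfolding t1 t1' by (intro sum.cong refl) (simp add: power2_eq_square)
    also have "\<dots> = 3 ^ h / 3 * (\<Sum>x\<in>{0,1,2}. (pair_v x x)\<^sup>2)"
      by (rule equidistribution1) auto
    also have "(\<Sum>x\<in>{0,1,2}. (pair_v x x)\<^sup>2) = 2 * (1 + 4 * r_const + 4 * r_const\<^sup>2)"
      using r_const_reduce by (simp add: pair_v_def power2_eq_square algebra_simps)
    finally show ?thesis
      by (simp add: t1 t1' \<kappa>_r_const)
  next
    case False
    then have "t \<noteq> t'" using t1 by auto
    with T_pair_gram_one[OF t'(1) False] show ?thesis
      by (simp only: t1) simp
  qed
next
  case False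
  note t_F3 = this
  show ?thesis
  proof (cases "t' \<in> F3")
    case True
    then have "t' = \<one>" using t' by (auto simp: uminus_eq_double)
    moreover from this have "t \<noteq> t'" using False by auto
    ultimately show ?thesis
      using T_pair_gram_one[OF t(1) False] by (simp add: mult.commute)
  next
    case False
    note t'_F3 = this
    show ?thesis
    proof (cases "t' \<in> span t")
      case True
      then obtain i j where ij: "t' = i \<oplus> j \<otimes> t" "i \<in> F3" "j \<in> F3"
        by (auto simp only: span_def mem_Collect_eq)
      have in_carrier: "i \<in> carrier R" "j \<in> carrier R"
        using ij by auto
      have "j \<noteq> \<zero>"
      proof
        assume "j = \<zero>"
        then have "t' = i" using ij t in_carrier by simp
        with ij(2) t'_F3 show False by blast
      qed
      obtain k where k: "k \<in> {0,1,2}" "k = 0 \<longleftrightarrow> i = \<zero>" "k = 1 \<longleftrightarrow> i = \<one>"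
        "\<forall>m\<in>carrier R. T (m \<otimes> i) = (k * T m) mod 3"
        by (rule F3_scalar[OF ij(2)])
      obtain l where l: "l \<in> {0,1,2}" "l = 0 \<longleftrightarrow> j = \<zero>" "l = 1 \<longleftrightarrow> j = \<one>"
        "\<forall>m\<in>carrier R. T (m \<otimes> j) = (l * T m) mod 3"
        by (rule F3_scalar[OF ij(3)])
      have "l \<in> {1,2}" using l \<open>j \<noteq> \<zero>\<close> by auto
      moreover have "T (m \<otimes> t') = (k * T m + l * T (m \<otimes> t)) mod 3" if m: "m \<in> carrier R" for m
      proof -
        have "m \<otimes> t' = m \<otimes> i \<oplus> m \<otimes> t \<otimes> j"
          using m t in_carrier by (simp add: ij r_distr m_ac)
        with m t in_carrier show ?thesis
          by (simp add: T_add k(4) l(4) mod_simps)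
      qed
      moreover have "t = t' \<longleftrightarrow> k = 0 \<and> l = 1"
      proof
        assume "k = 0 \<and> l = 1"
        with k l ij t show "t = t'" by simp
      next
        assume eq: "t = t'"
        \<comment> \<open>The equation t = i + j t puts (1 - j) t in \<open>F3\<close>; as t lies
          outside \<open>F3\<close>, this forces j = 1 and then i = 0.\<close>
        have "j = \<one>"
        proof (rule ccontr)
          assume "j \<noteq> \<one>"
          then have "j = \<one> \<oplus> \<one>" using ij \<open>j \<noteq> \<zero>\<close> by auto
          then have "i \<oplus> t \<oplus> t = t"
            using eq ij t in_carrier by (simp add: l_distr a_assoc)
          then have "i \<oplus> t = \<zero>"
            using t in_carrier by simp
          then have "t = \<ominus> i"
            using t in_carrier by (metis a_comm minus_equality)
          then have "t \<in> F3"
            using subgroup.m_inv_closed[OF F3_subgroup ij(2)] by (simp only: a_inv_def)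
          with t_F3 show False by simp
        qed
        with eq ij t in_carrier have "i \<oplus> t = t" by simp
        with t in_carrier have "i = \<zero>" by simp
        with \<open>j = \<one>\<close> k l show "k = 0 \<and> l = 1" by simp
      qed
      ultimately show ?thesis
        using T_pair_gram_dependent[OF t(1) t_F3 k(1), of l t'] by simp
    next
      case False
      have "t \<noteq> t'" using False self_in_span[OF t(1)] by auto
      \<comment> \<open>For fixed y the sum over x and z is the square of an autocorrelation of the
        three values, which gives (4 + 1 + 1) (1 + eta)^2 in total.\<close>
      have "(\<Sum>m\<in>carrier R. pair_v (T m) (T (m \<otimes> t)) * pair_v (T m) (T (m \<otimes> t')))
          = 3 ^ h / 27 * (\<Sum>y\<in>{0,1,2}. \<Sum>x\<in>{0,1,2}. \<Sum>z\<in>{0,1,2}. pair_v y x * pair_v y z)"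
        by (rule equidistribution3[OF t(1) t_F3 t'(1) False])
      also have "(\<Sum>y\<in>{0,1,2}. \<Sum>x\<in>{0,1,2}. \<Sum>z\<in>{0,1,2}. pair_v y x * pair_v y z)
          = 9 * (1 + 4 * r_const + 4 * r_const\<^sup>2)"
        using r_const_reduce by (simp add: pair_v_def power2_eq_square algebra_simps)
      also have "3 ^ h / 27 * \<dots> = \<kappa> (3 ^ h)"
        by (simp add: \<kappa>_r_const)
      finally show ?thesis
        using \<open>t \<noteq> t'\<close> by simp
    qed
  qed
qed

end

section \<open>Numerical bounds\<close>

lemma N_const_eq: "N_const q = real q * (2 - sqrt 2) - 1"
  by (simp add: N_const_def a_const_def eta_const_def field_simps)

lemma sqrt_2_bounds: "sqrt 2 < 3 / 2" "7 / 5 < sqrt 2"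
  by (rule real_less_lsqrt real_less_rsqrt; simp add: power2_eq_square)+

lemma N_const_pos: "9 \<le> q \<Longrightarrow> 0 < N_const q"
proof -
  assume "9 \<le> q"
  then have "9 * (1 / 2) \<le> real q * (2 - sqrt 2)"
    using sqrt_2_bounds by (intro mult_mono) auto
  then show ?thesis by (simp add: N_const_eq)
qed

text \<open>Makes the coefficients \<open>\<kappa> q - 1\<close> and
  \<open>2 * \<kappa> q - 1\<close> of the rank-one terms nonnegative, so that dropping these terms
  gives a lower bound.\<close>

lemma one_le_\<kappa>: "9 \<le> q \<Longrightarrow> 1 \<le> \<kappa> q"
proof -
  assume "9 \<le> q"
  moreover have "(2 / 5)\<^sup>2 \<le> (sqrt 2 - 1)\<^sup>2"
    using sqrt_2_bounds by (intro power_mono) auto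
  ultimately have "9 * (2 / 5)\<^sup>2 \<le> real q * (sqrt 2 - 1)\<^sup>2"
    by (intro mult_mono) auto
  then show ?thesis by (simp add: \<kappa>_def power_divide)
qed

section \<open>Quadratic forms of the two matrices\<close>

context ternary_field
begin

abbreviation "K \<equiv> carrier R - {\<zero>}"
abbreviation "J \<equiv> carrier R - {\<zero>, \<ominus> \<one>}"
abbreviation "q \<equiv> 3 ^ h :: nat"
abbreviation "N \<equiv> N_const q"
abbreviation "\<phi> \<equiv> phi_vec R h"

lemma q_ge: "9 \<le> q"
  using power_increasing[OF h_ge, of "3::nat"] by simp

lemma N_pos: "0 < N"
  using q_ge by (rule N_const_pos)

lemma phi_eq: "\<phi> m = idx_v (T m) / sqrt N"
  by (auto simp: phi_vec_def idx_v_def T_def)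

text \<open>Equidistribution needs the whole field, while the matrices omit the index 0. At 0 the
  summands in question equal 1, which accounts for every -1 below.\<close>

lemma sum_K: "(\<Sum>m\<in>K. f m) = (\<Sum>m\<in>carrier R. f m) - (f \<zero> :: real)"
  using finite_carrier by (simp add: sum_diff1)

lemma norm_phi: "l2_norm (carrier (mult_of R)) (phi_cvec R h) = 1"
proof -
  have "(\<Sum>m\<in>carrier R. (idx_v (T (m \<otimes> \<one>)))\<^sup>2) = q / 3 * (\<Sum>x\<in>{0,1,2}. (idx_v x)\<^sup>2)"
    by (simp only: equidistribution1[OF one_closed one_not_zero, of "\<lambda>x. (idx_v x)\<^sup>2"]) simp
  also have "\<dots> = N + 1"
    using r_const_quadratic
    by (simp add: N_const_def a_const_def r_const_quadratic[symmetric] power2_eq_square algebra_simps add_divide_distrib)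
  finally have "(\<Sum>m\<in>carrier R. (idx_v (T m))\<^sup>2) = N + 1"
    by (simp cong: sum.cong)
  then have "(\<Sum>m\<in>K. (\<phi> m)\<^sup>2) = 1"
    using N_pos unfolding phi_eq
    by (simp add: power_divide sum_divide_distrib[symmetric] sum_K)
  then have "(l2_norm (carrier (mult_of R)) (phi_cvec R h))\<^sup>2 = 1"
    by (simp add: l2_norm_power2)
  with l2_norm_nonneg show ?thesis
    by (metis abs_of_nonneg power2_eq_1_iff abs_1 abs_minus_cancel)
qed

lemma B_norm:
  "(\<Sum>m\<in>K. (cmod (matrix_apply J (\<lambda>i. complex_of_real (B_mat R \<phi> i)) z m))\<^sup>2)
    = \<kappa> q / N\<^sup>2 * (\<Sum>t\<in>J. (cmod (z t))\<^sup>2) + (\<kappa> q - 1) / N\<^sup>2 * (cmod (\<Sum>t\<in>J. z t))\<^sup>2"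
  unfolding matrix_apply_def
proof (rule gram_form)
  fix t t' assume t: "t \<in> J" "t' \<in> J"
  have B: "B_mat R \<phi> (m, t) = pair_v (T m) (T (m \<otimes> t)) / N" if "m \<in> carrier R" "t \<in> J" for m t
    using that N_pos by (simp add: B_mat_def phi_eq pair_v_def r_distr T_add)
  have "(\<Sum>m\<in>K. B_mat R \<phi> (m, t) * B_mat R \<phi> (m, t'))
      = (\<Sum>m\<in>K. pair_v (T m) (T (m \<otimes> t)) * pair_v (T m) (T (m \<otimes> t'))) / N\<^sup>2"
    unfolding sum_divide_distrib
    by (intro sum.cong refl) (use t B in \<open>simp add: power2_eq_square\<close>)
  also have "\<dots> = (if t = t' then \<kappa> q / N\<^sup>2 else 0) + (\<kappa> q - 1) / N\<^sup>2"
    using t T_pair_gram[of t t'] unfolding sum_K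
    by (simp add: pair_v_def algebra_simps add_divide_distrib diff_divide_distrib)
  finally show "(\<Sum>m\<in>K. complex_of_real (B_mat R \<phi> (m, t)) * cnj (complex_of_real (B_mat R \<phi> (m, t'))))
      = of_real ((if t = t' then \<kappa> q / N\<^sup>2 else 0) + (\<kappa> q - 1) / N\<^sup>2)"
    by (simp only: complex_cnj_complex_of_real of_real_mult[symmetric] of_real_sum[symmetric])
qed (use finite_carrier in auto)

lemma phi_square_norm:
  "(\<Sum>l\<in>K. (cmod (\<Sum>m\<in>K. complex_of_real ((\<phi> (l \<otimes> m))\<^sup>2) * z m))\<^sup>2)
    = \<kappa> q / N\<^sup>2 * (\<Sum>m\<in>K. (cmod (z m))\<^sup>2) + (2 * \<kappa> q - 1) / N\<^sup>2 * (cmod (\<Sum>m\<in>K. z m))\<^sup>2"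
proof (rule gram_form)
  fix m m' assume m: "m \<in> K" "m' \<in> K"
  have "(\<Sum>l\<in>K. (\<phi> (l \<otimes> m))\<^sup>2 * (\<phi> (l \<otimes> m'))\<^sup>2)
      = (\<Sum>l\<in>K. (idx_v (T (l \<otimes> m)))\<^sup>2 * (idx_v (T (l \<otimes> m')))\<^sup>2) / N\<^sup>2"
    unfolding sum_divide_distrib
    by (intro sum.cong refl) (use N_pos in \<open>simp add: phi_eq power_divide power2_eq_square[of N]\<close>)
  also have "\<dots> = (if m = m' then \<kappa> q / N\<^sup>2 else 0) + (2 * \<kappa> q - 1) / N\<^sup>2"
    using m T_sum_gram[of m m'] unfolding sum_K
    by (simp add: algebra_simps add_divide_distrib diff_divide_distrib)
  finally show "(\<Sum>l\<in>K. complex_of_real ((\<phi> (l \<otimes> m))\<^sup>2) * cnj (complex_of_real ((\<phi> (l \<otimes> m'))\<^sup>2)))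
      = of_real ((if m = m' then \<kappa> q / N\<^sup>2 else 0) + (2 * \<kappa> q - 1) / N\<^sup>2)"
    by (simp only: complex_cnj_complex_of_real of_real_mult[symmetric] of_real_sum[symmetric])
qed (use finite_carrier in auto)

lemma sigma_min_B_eq: "sigma_min_B R \<phi> = sqrt (\<kappa> q / N\<^sup>2)"
proof -
  have "0 \<le> \<kappa> q" "0 \<le> (\<kappa> q - 1) / N\<^sup>2"
    using one_le_\<kappa>[OF q_ge] by auto
  have "card J = q - 2"
    using finite_carrier two_neq by (subst card_Diff_subset) (auto simp: card_carrier uminus_eq_double)
  then have "card (J - {\<one>}) > 0"
    using q_ge two_neq finite_carrier by (simp add: uminus_eq_double)
  then obtain t where t: "t \<in> J" "t \<noteq> \<one>"
    by (metis DiffE card_gt_0_iff ex_in_conv insertCI)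
  have one: "\<one> \<in> J"
    using two_neq by (simp add: uminus_eq_double)
  \<comment> \<open>A difference of two unit vectors has sum zero, so the rank-one term of
    \<open>B_norm\<close> vanishes on it.\<close>
  define z :: "'a \<Rightarrow> complex" where "z = (\<lambda>x. if x = \<one> then 1 else if x = t then - 1 else 0)"
  have "(\<Sum>x\<in>J. z x) = (\<Sum>x\<in>{\<one>, t}. z x)"
    using finite_carrier t one by (intro sum.mono_neutral_right) (auto simp: z_def)
  also have "\<dots> = 0" using t by (simp add: z_def)
  finally have z0: "(\<Sum>x\<in>J. z x) = 0" .
  show ?thesis
    unfolding sigma_min_B_def Let_def
  proof (rule sigma_min_eqI[where x = \<one> and f = z])
    show "z \<one> \<noteq> 0" by (simp add: z_def)
    show "(\<Sum>y\<in>carrier (mult_of R). (cmod (matrix_apply J (\<lambda>i. complex_of_real (B_mat R \<phi> i)) z y))\<^sup>2)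
        = \<kappa> q / N\<^sup>2 * (\<Sum>x\<in>J. (cmod (z x))\<^sup>2)"
      by (simp only: carrier_mult_of B_norm z0) simp
    fix f
    show "\<kappa> q / N\<^sup>2 * (\<Sum>x\<in>J. (cmod (f x))\<^sup>2)
        \<le> (\<Sum>y\<in>carrier (mult_of R). (cmod (matrix_apply J (\<lambda>i. complex_of_real (B_mat R \<phi> i)) f y))\<^sup>2)"
      using mult_nonneg_nonneg[OF \<open>0 \<le> (\<kappa> q - 1) / N\<^sup>2\<close> zero_le_power2]
      by (simp only: carrier_mult_of B_norm le_add_same_cancel1)
  qed (use finite_carrier one \<open>0 \<le> \<kappa> q\<close> in auto)
qed

section \<open>Multiplicative characters\<close>

lemma bij_mult_K: "l \<in> K \<Longrightarrow> bij_betw (\<lambda>m. l \<otimes> m) K K"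
  using group.inj_on_cmult[OF field_mult_group, of l] group.surj_const_mult[OF field_mult_group, of l]
  by (simp add: bij_betw_def)

text \<open>
  Multiplying the argument by \<open>l\<close> only changes the character sum by a phase, so its modulus
  follows from the norm over all \<open>l\<close>; no Gauss sum has to be evaluated.
\<close>

lemma cmod_c_coeff:
  assumes \<omega>: "nontrivial_character (mult_of R) \<omega>"
  shows "cmod (c_coeff R \<phi> \<omega>) = sqrt (\<kappa> q / N\<^sup>2)"
proof -
  have unit: "cmod (\<omega> x) = 1" if "x \<in> K" for x
    using \<omega> that unfolding nontrivial_character_def is_character_def by auto
  have mult: "\<omega> (x \<otimes> y) = \<omega> x * \<omega> y" if "x \<in> K" "y \<in> K" for x y
    using \<omega> that unfolding nontrivial_character_def is_character_def by auto
  define D where "D l = (\<Sum>m\<in>K. complex_of_real ((\<phi> (l \<otimes> m))\<^sup>2) * \<omega> m)" for l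
  have shift: "cmod (D l) = cmod (D \<one>)" if l: "l \<in> K" for l
  proof -
    have "D \<one> = (\<Sum>m\<in>K. complex_of_real ((\<phi> (\<one> \<otimes> (l \<otimes> m)))\<^sup>2) * \<omega> (l \<otimes> m))"
      unfolding D_def by (rule sum.reindex_bij_betw[OF bij_mult_K[OF l], symmetric])
    also have "\<dots> = \<omega> l * D l"
      unfolding D_def sum_distrib_left using l by (intro sum.cong refl) (simp add: mult)
    finally show ?thesis
      using unit[OF l] by (simp add: norm_mult)
  qed
  \<comment> \<open>The argument -m in the definition of the coefficient is the dilation by
    -1.\<close>
  have "c_coeff R \<phi> \<omega> = D (\<ominus> \<one>)"
    unfolding c_coeff_def D_def by (intro sum.cong) (simp_all add: l_minus)
  then have c: "cmod (c_coeff R \<phi> \<omega>) = cmod (D \<one>)"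
    using shift[of "\<ominus> \<one>"] by simp
  have "(\<Sum>m\<in>K. \<omega> m) = 0"
    using character_sum_eq_0[OF field_mult_group \<omega>] by simp
  then have "(\<Sum>l\<in>K. (cmod (D l))\<^sup>2) = \<kappa> q / N\<^sup>2 * (\<Sum>m\<in>K. (cmod (\<omega> m))\<^sup>2)"
    unfolding D_def phi_square_norm by simp
  moreover have "(\<Sum>l\<in>K. (cmod (D l))\<^sup>2) = (\<Sum>l\<in>K. (cmod (D \<one>))\<^sup>2)"
    by (rule sum.cong[OF refl]) (subst shift, auto)
  moreover have "(\<Sum>m\<in>K. (cmod (\<omega> m))\<^sup>2) = (\<Sum>m\<in>K. 1)"
    by (rule sum.cong[OF refl]) (subst unit, auto)
  ultimately have "card K * (cmod (D \<one>))\<^sup>2 = \<kappa> q / N\<^sup>2 * card K"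
    by simp
  moreover have "card K \<noteq> 0"
    using finite_carrier one_closed one_not_zero
    by (metis DiffI card_eq_0_iff empty_iff finite_Diff singletonD)
  ultimately have "(cmod (D \<one>))\<^sup>2 = \<kappa> q / N\<^sup>2"
    by (metis mult.commute mult_right_cancel of_nat_eq_0_iff)
  then show ?thesis
    unfolding c by (metis norm_ge_zero real_sqrt_unique)
qed

text \<open>Without a nontrivial character the minimum over characters would be empty. The witness
  is the quadratic character: q is odd, x^((q-1)/2) is 1 or -1 by Fermat, and X^((q-1)/2) - 1 has
  too few roots to be satisfied by every unit.\<close>

lemma exists_nontrivial_character: "\<exists>\<omega>. nontrivial_character (mult_of R) \<omega>"
proof -
  obtain n where n: "q - 1 = 2 * n"
    by (rule evenE[of "q - 1"]) simp
  define \<omega> :: "'a \<Rightarrow> complex" where "\<omega> x = (if x [^] n = \<one> then 1 else - 1)" for x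
  have pow: "x [^] n = \<one> \<or> x [^] n = \<ominus> \<one>" if x: "x \<in> K" for x
  proof -
    have "x [^] (order (mult_of R)) = \<one>"
      using group.pow_order_eq_1[OF field_mult_group, of x] x by (simp add: nat_pow_mult_of)
    then have "x [^] (2 * n) = \<one>"
      using n by (simp add: order_mult_of finite_carrier order_def[of R] card_carrier)
    then have "x [^] n \<otimes> x [^] n = \<one>"
      using x by (simp add: nat_pow_mult mult_2)
    then show ?thesis
      using x square_eq_one[of "x [^] n"] by simp
  qed
  have "card {x \<in> carrier R. x [^] n = \<one>} \<le> n"
    using n q_ge by (intro num_roots_le_deg finite_carrier) auto
  moreover have "card K = 2 * n"
    using n finite_carrier by (simp add: card_carrier)
  ultimately have "\<not> K \<subseteq> {x \<in> carrier R. x [^] n = \<one>}"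
    using card_mono[of "{x \<in> carrier R. x [^] n = \<one>}" K] finite_carrier n q_ge by auto
  then obtain x where x: "x \<in> K" "x [^] n \<noteq> \<one>" by auto
  have neq: "\<ominus> \<one> \<noteq> \<one>"
    using two_neq by (simp add: uminus_eq_double)
  have "\<omega> (x \<otimes> y) = \<omega> x * \<omega> y" if "x \<in> K" "y \<in> K" for x y
  proof -
    have "(x \<otimes> y) [^] n = x [^] n \<otimes> y [^] n"
      using that by (simp add: nat_pow_distrib)
    then show ?thesis
      using pow[OF that(1)] pow[OF that(2)] neq by (auto simp: \<omega>_def l_minus)
  qed
  then have "nontrivial_character (mult_of R) \<omega>"
    using x unfolding nontrivial_character_def is_character_def
    by (auto simp: \<omega>_def)
  then show ?thesis by blast
qed

text \<open>All these moduli coincide, so any one of them is the minimum.\<close>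

lemma least_c_coeff:
  "(LEAST s. \<exists>\<omega>. nontrivial_character (mult_of R) \<omega> \<and> s = cmod (c_coeff R \<phi> \<omega>)) = sqrt (\<kappa> q / N\<^sup>2)"
  using exists_nontrivial_character by (intro Least_equality) (auto simp: cmod_c_coeff)

end

section \<open>The measurement map\<close>

lemma (in field) parseval:
  assumes \<psi>: "nontrivial_character (add_monoid R) \<psi>" and fin: "finite (carrier R)"
  shows "(\<Sum>k\<in>carrier R. (cmod (\<Sum>e\<in>carrier R. \<psi> (k \<otimes> e) * z e))\<^sup>2)
    = card (carrier R) * (\<Sum>e\<in>carrier R. (cmod (z e))\<^sup>2)"
proof -
  have "(\<Sum>k\<in>carrier R. \<psi> (k \<otimes> e) * cnj (\<psi> (k \<otimes> e')))
      = of_real ((if e = e' then real (card (carrier R)) else 0) + 0)"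
    if e: "e \<in> carrier R" "e' \<in> carrier R" for e e'
  proof -
    have "(\<Sum>k\<in>carrier R. \<psi> (k \<otimes> e) * cnj (\<psi> (k \<otimes> e'))) = (\<Sum>k\<in>carrier R. \<psi> (k \<otimes> (e \<ominus> e')))"
      using e by (intro sum.cong refl)
        (simp add: additive_character_diff[OF \<psi>, symmetric] minus_eq r_distr r_minus)
    also have "\<dots> = of_real ((if e = e' then real (card (carrier R)) else 0) + 0)"
    proof (cases "e = e'")
      case True
      then show ?thesis
        using e nontrivial_character_zero[OF abelian_group_axioms \<psi>] by (simp add: minus_eq r_neg)
    next
      case False
      then show ?thesis
        using e additive_character_sum[OF \<psi>, of "e \<ominus> e'"] by simp
    qed
    finally show ?thesis .
  qed
  from gram_form[OF fin this, of z] show ?thesis by simp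
qed

context ternary_field
begin

lemma sum_diagonal_fiber:
  "(\<Sum>p | p \<in> K \<times> K \<and> snd p \<ominus> fst p = \<zero>. f p) = (\<Sum>m\<in>K. f (m, m))"
  by (rule sum.reindex_bij_witness[of _ "\<lambda>m. (m, m)" fst]) auto

text \<open>A pair (m, n) with n - m = e is determined by t = m/e. Then m is nonzero iff t is not 0,
  and n is nonzero iff t is not -1: this is the column set of B_phi.\<close>

lemma sum_off_diagonal_fiber:
  assumes e: "e \<in> K"
  shows "(\<Sum>p | p \<in> K \<times> K \<and> snd p \<ominus> fst p = e. f p) = (\<Sum>t\<in>J. f (e \<otimes> t, e \<otimes> (t \<oplus> \<one>)))"
proof (rule sum.reindex_bij_witness[of _ "\<lambda>t. (e \<otimes> t, e \<otimes> (t \<oplus> \<one>))" "\<lambda>p. inv e \<otimes> fst p"])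
  have inv: "inv e \<in> carrier R" "e \<otimes> inv e = \<one>" "inv e \<otimes> e = \<one>"
    using e by (simp_all add: field_Units)
  have cancel: "e \<otimes> (inv e \<otimes> m) = m" "inv e \<otimes> (e \<otimes> m) = m" if "m \<in> carrier R" for m
    using that e inv by (simp_all add: m_assoc[symmetric])
  {
    fix p assume p: "p \<in> {p. p \<in> K \<times> K \<and> snd p \<ominus> fst p = e}"
    obtain m n where mn: "p = (m, n)" by (cases p)
    have m: "m \<in> K" "n \<in> K" "n \<ominus> m = e" using p mn by auto
    have "m \<oplus> (n \<oplus> \<ominus> m) = n \<oplus> (m \<oplus> \<ominus> m)"
      using m(1,2) by (intro a_lcomm) auto
    then have n: "n = m \<oplus> e"
      using m by (simp add: minus_eq r_neg)
    have t1: "e \<otimes> (inv e \<otimes> m \<oplus> \<one>) = n"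
      using m e inv by (simp add: r_distr cancel n)
    show *: "(e \<otimes> (inv e \<otimes> fst p), e \<otimes> (inv e \<otimes> fst p \<oplus> \<one>)) = p"
      using m t1 by (simp add: mn cancel)
    have "inv e \<otimes> m \<noteq> \<zero>" using cancel(1)[of m] m e by auto
    moreover have "inv e \<otimes> m \<noteq> \<ominus> \<one>"
    proof
      assume "inv e \<otimes> m = \<ominus> \<one>"
      then have "n = \<zero>" using t1 e by (simp add: l_neg)
      with m show False by simp
    qed
    ultimately show "inv e \<otimes> fst p \<in> J" using m inv by (simp add: mn)
    show "f (e \<otimes> (inv e \<otimes> fst p), e \<otimes> (inv e \<otimes> fst p \<oplus> \<one>)) = f p"
      using * by simp
  next
    fix t assume t: "t \<in> J"
    show "inv e \<otimes> fst (e \<otimes> t, e \<otimes> (t \<oplus> \<one>)) = t"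
      using t by (simp add: cancel)
    have "t \<oplus> \<one> \<noteq> \<zero>"
      using t minus_equality[of t \<one>] by auto
    then have "e \<otimes> t \<in> K" "e \<otimes> (t \<oplus> \<one>) \<in> K"
      using t e by (auto simp: integral_iff)
    moreover have "e \<otimes> (t \<oplus> \<one>) \<ominus> e \<otimes> t = e"
      using t e by (simp add: r_distr minus_eq a_ac r_neg)
    ultimately show "(e \<otimes> t, e \<otimes> (t \<oplus> \<one>)) \<in> {p. p \<in> K \<times> K \<and> snd p \<ominus> fst p = e}"
      by simp
  }
qed

lemma sum_fibers:
  fixes f :: "'a \<times> 'a \<Rightarrow> real"
  shows "(\<Sum>p\<in>K \<times> K. f p)
    = (\<Sum>m\<in>K. f (m, m)) + (\<Sum>e\<in>K. \<Sum>t\<in>J. f (e \<otimes> t, e \<otimes> (t \<oplus> \<one>)))"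
proof -
  have "(\<Sum>p\<in>K \<times> K. f p) = (\<Sum>e\<in>carrier R. \<Sum>p | p \<in> K \<times> K \<and> snd p \<ominus> fst p = e. f p)"
    using finite_carrier by (intro sum.group[symmetric]) auto
  also have "\<dots> = (\<Sum>p | p \<in> K \<times> K \<and> snd p \<ominus> fst p = \<zero>. f p)
      + (\<Sum>e\<in>K. \<Sum>p | p \<in> K \<times> K \<and> snd p \<ominus> fst p = e. f p)"
    using finite_carrier by (intro sum.remove) auto
  finally show ?thesis
    by (simp only: sum_diagonal_fiber sum_off_diagonal_fiber cong: sum.cong)
qed

text \<open>The two character values combine to \<psi>(k(n - m)), so for fixed l the map is a
  Fourier transform in k of sums over the fibres of n - m.\<close>

lemma M_map_expand:
  assumes \<psi>: "nontrivial_character (add_monoid R) \<psi>" and kl: "k \<in> carrier R" "l \<in> K"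
  shows "M_map R \<psi> (phi_cvec R h) A (k, l) = (\<Sum>e\<in>carrier R. \<psi> (k \<otimes> e) *
    (\<Sum>p | p \<in> K \<times> K \<and> snd p \<ominus> fst p = e. A p * of_real (\<phi> (l \<otimes> snd p) * \<phi> (l \<otimes> fst p))))"
proof -
  have "M_map R \<psi> (phi_cvec R h) A (k, l)
      = (\<Sum>m\<in>K. \<Sum>n\<in>K. A (m, n) * of_real (\<phi> (l \<otimes> n) * \<phi> (l \<otimes> m)) * (\<psi> (k \<otimes> n) * cnj (\<psi> (k \<otimes> m))))"
    by (simp add: M_map_def l2_inner_def matrix_apply_def affine_rep_def sum_distrib_right
        sum_distrib_left mult_ac)
  also have "\<dots> = (\<Sum>m\<in>K. \<Sum>n\<in>K. \<psi> (k \<otimes> (n \<ominus> m)) * (A (m, n) * of_real (\<phi> (l \<otimes> n) * \<phi> (l \<otimes> m))))"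
    using kl by (intro sum.cong refl)
      (simp add: additive_character_diff[OF \<psi>, symmetric] minus_eq r_distr r_minus)
  also have "\<dots> = (\<Sum>p\<in>K \<times> K. \<psi> (k \<otimes> (snd p \<ominus> fst p)) * (A p * of_real (\<phi> (l \<otimes> snd p) * \<phi> (l \<otimes> fst p))))"
    by (simp add: sum.cartesian_product split_beta)
  also have "\<dots> = (\<Sum>e\<in>carrier R. \<Sum>p | p \<in> K \<times> K \<and> snd p \<ominus> fst p = e.
      \<psi> (k \<otimes> (snd p \<ominus> fst p)) * (A p * of_real (\<phi> (l \<otimes> snd p) * \<phi> (l \<otimes> fst p))))"
    using finite_carrier by (intro sum.group[symmetric]) auto
  also have "\<dots> = (\<Sum>e\<in>carrier R. \<psi> (k \<otimes> e) *
    (\<Sum>p | p \<in> K \<times> K \<and> snd p \<ominus> fst p = e. A p * of_real (\<phi> (l \<otimes> snd p) * \<phi> (l \<otimes> fst p))))"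
    unfolding sum_distrib_left by (intro sum.cong refl) auto
  finally show ?thesis .
qed

lemma M_norm:
  assumes \<psi>: "nontrivial_character (add_monoid R) \<psi>"
  shows "(\<Sum>g\<in>carrier (affine_group R). (cmod (M_map R \<psi> (phi_cvec R h) A g))\<^sup>2)
    = q * (\<kappa> q / N\<^sup>2 * (\<Sum>p\<in>K \<times> K. (cmod (A p))\<^sup>2)
      + (2 * \<kappa> q - 1) / N\<^sup>2 * (cmod (\<Sum>m\<in>K. A (m, m)))\<^sup>2
      + (\<kappa> q - 1) / N\<^sup>2 * (\<Sum>e\<in>K. (cmod (\<Sum>t\<in>J. A (e \<otimes> t, e \<otimes> (t \<oplus> \<one>))))\<^sup>2))"
proof -
  define b where "b l e = (\<Sum>p | p \<in> K \<times> K \<and> snd p \<ominus> fst p = e.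
    A p * of_real (\<phi> (l \<otimes> snd p) * \<phi> (l \<otimes> fst p)))" for l e
  let ?z = "\<lambda>e t. A (e \<otimes> t, e \<otimes> (t \<oplus> \<one>))"
  have "(\<Sum>g\<in>carrier (affine_group R). (cmod (M_map R \<psi> (phi_cvec R h) A g))\<^sup>2)
      = (\<Sum>k\<in>carrier R. \<Sum>l\<in>K. (cmod (M_map R \<psi> (phi_cvec R h) A (k, l)))\<^sup>2)"
    by (simp add: affine_group_def sum.cartesian_product split_beta)
  also have "\<dots> = (\<Sum>l\<in>K. \<Sum>k\<in>carrier R. (cmod (\<Sum>e\<in>carrier R. \<psi> (k \<otimes> e) * b l e))\<^sup>2)"
    by (subst sum.swap, intro sum.cong refl) (simp only: M_map_expand[OF \<psi>] b_def)
  also have "\<dots> = q * (\<Sum>l\<in>K. \<Sum>e\<in>carrier R. (cmod (b l e))\<^sup>2)"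
    unfolding parseval[OF \<psi> finite_carrier] sum_distrib_left by (simp add: card_carrier)
  also have "(\<Sum>l\<in>K. \<Sum>e\<in>carrier R. (cmod (b l e))\<^sup>2)
      = (\<Sum>l\<in>K. (cmod (b l \<zero>))\<^sup>2) + (\<Sum>e\<in>K. \<Sum>l\<in>K. (cmod (b l e))\<^sup>2)"
    using finite_carrier by (subst sum.swap, intro sum.remove) auto
  also have "(\<Sum>l\<in>K. (cmod (b l \<zero>))\<^sup>2)
      = (\<Sum>l\<in>K. (cmod (\<Sum>m\<in>K. complex_of_real ((\<phi> (l \<otimes> m))\<^sup>2) * A (m, m)))\<^sup>2)"
    unfolding b_def sum_diagonal_fiber by (simp add: power2_eq_square mult.commute)
  also have "\<dots> = \<kappa> q / N\<^sup>2 * (\<Sum>m\<in>K. (cmod (A (m, m)))\<^sup>2)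
      + (2 * \<kappa> q - 1) / N\<^sup>2 * (cmod (\<Sum>m\<in>K. A (m, m)))\<^sup>2"
    by (rule phi_square_norm)
  also have "(\<Sum>e\<in>K. \<Sum>l\<in>K. (cmod (b l e))\<^sup>2)
      = (\<Sum>e\<in>K. \<kappa> q / N\<^sup>2 * (\<Sum>t\<in>J. (cmod (?z e t))\<^sup>2) + (\<kappa> q - 1) / N\<^sup>2 * (cmod (\<Sum>t\<in>J. ?z e t))\<^sup>2)"
  proof (intro sum.cong refl)
    fix e assume e: "e \<in> K"
    \<comment> \<open>Since phi(l e t) phi(l e (t+1)) is the entry of B_phi in row e l, the fibre
      over e only permutes the rows, which leaves the norm unchanged.\<close>
    have "b l e = matrix_apply J (\<lambda>i. complex_of_real (B_mat R \<phi> i)) (?z e) (e \<otimes> l)" if "l \<in> K" for l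
      unfolding b_def matrix_apply_def sum_off_diagonal_fiber[OF e]
      using that e by (intro sum.cong refl) (simp add: B_mat_def m_ac)
    then have "(\<Sum>l\<in>K. (cmod (b l e))\<^sup>2)
        = (\<Sum>l\<in>K. (cmod (matrix_apply J (\<lambda>i. complex_of_real (B_mat R \<phi> i)) (?z e) (e \<otimes> l)))\<^sup>2)"
      by (intro sum.cong refl) simp
    also have "\<dots> = (\<Sum>l\<in>K. (cmod (matrix_apply J (\<lambda>i. complex_of_real (B_mat R \<phi> i)) (?z e) l))\<^sup>2)"
      by (rule sum.reindex_bij_betw[OF bij_mult_K[OF e]])
    finally show "(\<Sum>l\<in>K. (cmod (b l e))\<^sup>2) = \<kappa> q / N\<^sup>2 * (\<Sum>t\<in>J. (cmod (?z e t))\<^sup>2)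
        + (\<kappa> q - 1) / N\<^sup>2 * (cmod (\<Sum>t\<in>J. ?z e t))\<^sup>2"
      unfolding B_norm .
  qed
  finally show ?thesis
    unfolding sum_fibers[of "\<lambda>p. (cmod (A p))\<^sup>2"]
    by (simp only: sum.distrib sum_distrib_left distrib_left add_ac)
qed

lemma sigma_min_M_sqrt:
  assumes \<psi>: "nontrivial_character (add_monoid R) \<psi>"
  shows "sigma_min_M R \<psi> (phi_cvec R h) = sqrt (q * (\<kappa> q / N\<^sup>2))"
proof -
  have nonneg: "0 \<le> \<kappa> q / N\<^sup>2" "0 \<le> (\<kappa> q - 1) / N\<^sup>2" "0 \<le> (2 * \<kappa> q - 1) / N\<^sup>2"
    using one_le_\<kappa>[OF q_ge] by auto
  have q_nonneg: "0 \<le> q * (\<kappa> q / N\<^sup>2)"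
    using nonneg(1) by (intro mult_nonneg_nonneg) auto
  let ?m = "\<ominus> \<one>"
  have neq: "?m \<noteq> \<one>" "?m \<noteq> \<zero>"
    using two_neq by (simp_all add: uminus_eq_double)
  \<comment> \<open>A diagonal matrix of trace zero: both rank-one contributions in
    \<open>M_norm\<close> vanish on it.\<close>
  define A :: "'a \<times> 'a \<Rightarrow> complex" where
    "A p = (if p = (\<one>, \<one>) then 1 else if p = (?m, ?m) then - 1 else 0)" for p
  have "(\<Sum>m\<in>K. A (m, m)) = (\<Sum>m\<in>{\<one>, ?m}. A (m, m))"
    using finite_carrier neq by (intro sum.mono_neutral_right) (auto simp: A_def)
  also have "\<dots> = 0" using neq by (auto simp: A_def)
  finally have diag: "(\<Sum>m\<in>K. A (m, m)) = 0" .
  have "A (e \<otimes> t, e \<otimes> (t \<oplus> \<one>)) = 0" if "e \<in> K" "t \<in> J" for e t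
  proof -
    have "e \<otimes> t \<noteq> e \<otimes> (t \<oplus> \<one>)"
      using that by (simp add: r_distr)
    then show ?thesis by (auto simp: A_def)
  qed
  then have off: "(\<Sum>e\<in>K. (cmod (\<Sum>t\<in>J. A (e \<otimes> t, e \<otimes> (t \<oplus> \<one>))))\<^sup>2) = 0"
    by simp
  show ?thesis
    unfolding sigma_min_M_def
  proof (rule sigma_min_eqI[where x = "(\<one>, \<one>)" and f = A])
    show "A (\<one>, \<one>) \<noteq> 0" by (simp add: A_def)
    show "(\<Sum>g\<in>carrier (affine_group R). (cmod (M_map R \<psi> (phi_cvec R h) A g))\<^sup>2)
        = q * (\<kappa> q / N\<^sup>2) * (\<Sum>p\<in>carrier (mult_of R) \<times> carrier (mult_of R). (cmod (A p))\<^sup>2)"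
      unfolding M_norm[OF \<psi>] diag off carrier_mult_of by simp
    fix f
    have "0 \<le> (2 * \<kappa> q - 1) / N\<^sup>2 * (cmod (\<Sum>m\<in>K. f (m, m)))\<^sup>2
        + (\<kappa> q - 1) / N\<^sup>2 * (\<Sum>e\<in>K. (cmod (\<Sum>t\<in>J. f (e \<otimes> t, e \<otimes> (t \<oplus> \<one>))))\<^sup>2)"
      using nonneg by (intro add_nonneg_nonneg mult_nonneg_nonneg sum_nonneg) auto
    then show "q * (\<kappa> q / N\<^sup>2) * (\<Sum>p\<in>carrier (mult_of R) \<times> carrier (mult_of R). (cmod (f p))\<^sup>2)
        \<le> (\<Sum>g\<in>carrier (affine_group R). (cmod (M_map R \<psi> (phi_cvec R h) f g))\<^sup>2)"
      unfolding M_norm[OF \<psi>] carrier_mult_of mult.assoc by (intro mult_left_mono) linarith+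
  qed (use finite_carrier q_nonneg in auto)
qed

lemma sigma_min_M_eq:
  assumes "nontrivial_character (add_monoid R) \<psi>"
  shows "sigma_min_M R \<psi> (phi_cvec R h) = real q * (sqrt 2 - 1) / (real q * (2 - sqrt 2) - 1)"
proof -
  have "q * (\<kappa> q / N\<^sup>2) = (real q * (sqrt 2 - 1) / N)\<^sup>2"
    by (simp add: \<kappa>_def power2_eq_square)
  moreover have "0 \<le> real q * (sqrt 2 - 1) / N"
    using N_pos by simp
  ultimately show ?thesis
    unfolding sigma_min_M_sqrt[OF assms] by (simp only: real_sqrt_unique[OF refl] N_const_eq)
qed

end

section \<open>Monotonicity and limit of the closed formula\<close>

definition stability_const :: "real \<Rightarrow> real" where
  "stability_const x = x * (sqrt 2 - 1) / (x * (2 - sqrt 2) - 1)"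

text \<open>As sqrt 2 (sqrt 2 - 1) = 2 - sqrt 2, the numerator is the denominator plus 1, divided by
  sqrt 2. This isolates the excess over 1 / sqrt 2, from which the strict bound and the decrease are
  read off.\<close>

lemma stability_const_eq:
  assumes "9 \<le> x"
  shows "stability_const x = 1 / sqrt 2 * (1 + 1 / (x * (2 - sqrt 2) - 1))"
    and "0 < x * (2 - sqrt 2) - 1"
proof -
  have "9 * (1 / 2) \<le> x * (2 - sqrt 2)"
    using sqrt_2_bounds assms by (intro mult_mono) auto
  then show pos: "0 < x * (2 - sqrt 2) - 1" by simp
  have "sqrt 2 * (sqrt 2 - 1) = 2 - sqrt 2"
    by (simp add: algebra_simps)
  then have "sqrt 2 * (x * (sqrt 2 - 1)) = x * (2 - sqrt 2)"
    by (metis mult.left_commute)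
  then show "stability_const x = 1 / sqrt 2 * (1 + 1 / (x * (2 - sqrt 2) - 1))"
    using pos by (simp add: stability_const_def divide_simps) (simp add: algebra_simps)
qed

lemma stability_const_gt: "9 \<le> x \<Longrightarrow> 1 / sqrt 2 < stability_const x"
  using stability_const_eq[of x] mult_strict_left_mono[of 1 "1 + 1 / (x * (2 - sqrt 2) - 1)" "1 / sqrt 2"]
  by simp

lemma stability_const_strict_antimono:
  assumes "9 \<le> x" "x < y"
  shows "stability_const y < stability_const x"
proof -
  have "x * (2 - sqrt 2) < y * (2 - sqrt 2)"
    using assms sqrt_2_bounds by (intro mult_strict_right_mono) auto
  then have "1 / (y * (2 - sqrt 2) - 1) < 1 / (x * (2 - sqrt 2) - 1)"
    using stability_const_eq(2)[OF assms(1)] by (intro divide_strict_left_mono) auto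
  then show ?thesis
    using assms by (simp add: stability_const_eq(1) divide_strict_right_mono)
qed

lemma stability_const_tendsto: "(\<lambda>h. stability_const (3 ^ h)) \<longlonglongrightarrow> 1 / sqrt 2"
proof -
  have "(\<lambda>h. (1 / 3) ^ h :: real) \<longlonglongrightarrow> 0"
    by (rule LIMSEQ_power_zero) simp
  then have "(\<lambda>h. (sqrt 2 - 1) / ((2 - sqrt 2) - (1 / 3) ^ h)) \<longlonglongrightarrow> (sqrt 2 - 1) / ((2 - sqrt 2) - 0)"
    using sqrt_2_bounds by (intro tendsto_intros) auto
  moreover have "(sqrt 2 - 1) / ((2 - sqrt 2) - 0) = 1 / sqrt 2"
    using sqrt_2_bounds by (simp add: field_simps)
  moreover have "(sqrt 2 - 1) / ((2 - sqrt 2) - (1 / 3) ^ h) = stability_const (3 ^ h)" for h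
  proof -
    have "stability_const (3 ^ h) = (3 ^ h * (sqrt 2 - 1)) / (3 ^ h * ((2 - sqrt 2) - (1 / 3) ^ h))"
      by (simp add: stability_const_def right_diff_distrib power_divide)
    then show ?thesis by simp
  qed
  ultimately show ?thesis by simp
qed

theorem theorem6p6:
  shows
    "(\<forall>(h::nat) (q::nat) (R :: ('a, 'm) ring_scheme) \<psi>.
        2 \<le> h \<and> q = 3 ^ h \<and> field R \<and> card (carrier R) = q \<and>
        nontrivial_character (add_monoid R) \<psi> \<longrightarrow>
          N_const q = real q * (2 - sqrt 2) - 1 \<and>
          l2_norm (carrier (mult_of R)) (phi_cvec R h) = 1 \<and>
          (LEAST s. \<exists>\<omega>. nontrivial_character (mult_of R) \<omega> \<and> s = cmod (c_coeff R (phi_vec R h) \<omega>))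
            = sigma_min_B R (phi_vec R h) \<and>
          sigma_min_B R (phi_vec R h)
            = sqrt (a_const q * (1 + 4 * eta_const)) / N_const q \<and>
          sigma_min_M R \<psi> (phi_cvec R h)
            = real q * (sqrt 2 - 1) / (real q * (2 - sqrt 2) - 1) \<and>
          sigma_min_M R \<psi> (phi_cvec R h) > 1 / sqrt 2) \<and>
     (\<forall>(F :: nat \<Rightarrow> ('a, 'm) ring_scheme) \<psi>.
        (\<forall>h\<ge>2. field (F h) \<and> card (carrier (F h)) = 3 ^ h \<and>
                nontrivial_character (add_monoid (F h)) (\<psi> h)) \<longrightarrow>
          (\<forall>h\<ge>2. \<forall>h'>h. sigma_min_M (F h') (\<psi> h') (phi_cvec (F h') h')
                        < sigma_min_M (F h) (\<psi> h) (phi_cvec (F h) h)) \<and>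
          (\<lambda>h. sigma_min_M (F h) (\<psi> h) (phi_cvec (F h) h)) \<longlonglongrightarrow> 1 / sqrt 2)"
proof -
  \<comment> \<open>The value depends on h alone, so any choice of fields and characters gives the
    same sequence.\<close>
  have sigma: "sigma_min_M R \<psi> (phi_cvec R h) = stability_const (3 ^ h)"
    if "2 \<le> h" "field R" "card (carrier R) = 3 ^ h" "nontrivial_character (add_monoid R) \<psi>"
    for h and R :: "('a, 'm) ring_scheme" and \<psi>
  proof -
    interpret ternary_field R h
      using that by (simp add: ternary_field_def ternary_field_axioms_def)
    show ?thesis
      using sigma_min_M_eq[OF that(4)] by (simp add: stability_const_def)
  qed
  have ge: "(9::real) \<le> 3 ^ h" if "2 \<le> h" for h :: nat
    using power_increasing[OF that, of "3::real"] by simp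
  have part1: "N_const q = real q * (2 - sqrt 2) - 1 \<and>
      l2_norm (carrier (mult_of R)) (phi_cvec R h) = 1 \<and>
      (LEAST s. \<exists>\<omega>. nontrivial_character (mult_of R) \<omega> \<and> s = cmod (c_coeff R (phi_vec R h) \<omega>))
        = sigma_min_B R (phi_vec R h) \<and>
      sigma_min_B R (phi_vec R h) = sqrt (a_const q * (1 + 4 * eta_const)) / N_const q \<and>
      sigma_min_M R \<psi> (phi_cvec R h) = real q * (sqrt 2 - 1) / (real q * (2 - sqrt 2) - 1) \<and>
      sigma_min_M R \<psi> (phi_cvec R h) > 1 / sqrt 2"
    if asm: "2 \<le> h" "q = 3 ^ h" "field R" "card (carrier R) = q" "nontrivial_character (add_monoid R) \<psi>"
    for h q and R :: "('a, 'm) ring_scheme" and \<psi>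
  proof -
    interpret ternary_field R h
      using asm by (simp add: ternary_field_def ternary_field_axioms_def)
    have "a_const q * (1 + 4 * eta_const) = \<kappa> q"
      by (simp add: a_const_def \<kappa>_r_const r_const_quadratic[symmetric] algebra_simps)
    then have "sigma_min_B R \<phi> = sqrt (a_const q * (1 + 4 * eta_const)) / N_const q"
      using N_pos by (simp add: sigma_min_B_eq real_sqrt_divide asm(2))
    moreover have "1 / sqrt 2 < sigma_min_M R \<psi> (phi_cvec R h)"
      using stability_const_gt[OF ge[OF asm(1)]] asm by (simp add: sigma)
    ultimately show ?thesis
      using N_const_eq norm_phi least_c_coeff sigma_min_B_eq sigma_min_M_eq[OF asm(5)] asm(2) by simp
  qed
  have part2: "(\<forall>h\<ge>2. \<forall>h'>h. sigma_min_M (F h') (\<psi> h') (phi_cvec (F h') h')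
          < sigma_min_M (F h) (\<psi> h) (phi_cvec (F h) h)) \<and>
      (\<lambda>h. sigma_min_M (F h) (\<psi> h) (phi_cvec (F h) h)) \<longlonglongrightarrow> 1 / sqrt 2"
    if asm: "\<forall>h\<ge>2. field (F h) \<and> card (carrier (F h)) = 3 ^ h \<and>
      nontrivial_character (add_monoid (F h)) (\<psi> h)"
    for F :: "nat \<Rightarrow> ('a, 'm) ring_scheme" and \<psi>
  proof -
    have eq: "sigma_min_M (F h) (\<psi> h) (phi_cvec (F h) h) = stability_const (3 ^ h)" if "2 \<le> h" for h
      using that asm by (intro sigma) auto
    \<comment> \<open>The family is controlled only from h = 2 on, hence the limit is transferred by
      eventual equality.\<close>
    have "\<forall>\<^sub>F h in sequentially. stability_const (3 ^ h) = sigma_min_M (F h) (\<psi> h) (phi_cvec (F h) h)"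
      using eventually_ge_at_top[of 2] by eventually_elim (simp add: eq)
    with stability_const_tendsto have "(\<lambda>h. sigma_min_M (F h) (\<psi> h) (phi_cvec (F h) h)) \<longlonglongrightarrow> 1 / sqrt 2"
      by (rule Lim_transform_eventually)
    moreover have "sigma_min_M (F h') (\<psi> h') (phi_cvec (F h') h') < sigma_min_M (F h) (\<psi> h) (phi_cvec (F h) h)"
      if "2 \<le> h" "h < h'" for h h'
      using that ge[of h] by (simp add: eq stability_const_strict_antimono)
    ultimately show ?thesis by blast
  qed
  from part1 part2 show ?thesis by blast
qed

end
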